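(* Let $\psi:\mathbf{N}\to\overline{\mathbf{N}}$ be an admissible function. The power series $G_\psi(T)=\sum_{n\in\mathbf{N}_\psi}2^{\psi(n)}T^n$ is rational (i.e. is the expansion of a rational fraction) if and only if its value $G_\psi(1/\sqrt{3})$, computed in $\mathbf{Q}_2(\sqrt3)$, lies in $\mathbf{Q}(\sqrt{3})\cap\mathbf{Z}_2[\sqrt{3}]$.
   Context: $\mathbf{N}=\{0,1,2,\dots\}$ and $\overline{\mathbf{N}}=\mathbf{N}\cup\{+\infty\}$. A map $\psi:\mathbf{N}\to\overline{\mathbf{N}}$ is called admissible if (1) the set $\mathbf{N}_\psi=\psi^{-1}(\mathbf{N})$ is either of the form $\{i\in\mathbf{N}: i\le N\}$ for some $N$, or equal to $\mathbf{N}$; and (2) $\psi$ is strictly increasing on $\mathbf{N}_\psi$. The field $\mathbf{Q}(\sqrt3)$ is viewed inside the quadratic extension $\mathbf{Q}_2(\sqrt3)$ of $\mathbf{Q}_2$, which also contains $\mathbf{Z}_2[\sqrt3]$. *)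

theory Defs
  imports
    Complex_Main
    "HOL-Computational_Algebra.Computational_Algebra"
    "HOL-Library.Extended_Nat"
begin

section \<open>The 2-adic absolute value on the rationals\<close>

definition val2 :: "rat \<Rightarrow> int" where
  "val2 x = int (multiplicity 2 (fst (quotient_of x))) - int (multiplicity 2 (snd (quotient_of x)))"

definition abs2 :: "rat \<Rightarrow> real" where
  "abs2 x = (if x = 0 then 0 else 2 powi (- val2 x))"

lemma abs2_quotient:
  assumes "a \<noteq> 0" "b \<noteq> 0"
  shows "abs2 (of_int a / of_int b) = 2 powi (int (multiplicity 2 b) - int (multiplicity 2 a))"
proof -
  obtain p q where pq: "quotient_of (of_int a / of_int b) = (p, q)"
    by (cases "quotient_of (of_int a / of_int b)") auto
  have q: "q > 0" using quotient_of_denom_pos[OF pq] .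
  have eq: "(of_int a / of_int b :: rat) = of_int p / of_int q"
    using quotient_of_div[OF pq] .
  hence p: "p \<noteq> 0" using assms q by auto
  from eq have "of_int (a * q) = (of_int (p * b) :: rat)"
    using assms q by (simp add: field_simps)
  hence "a * q = p * b" by (simp only: of_int_eq_iff)
  hence "multiplicity 2 (a * q) = multiplicity 2 (p * b)" by simp
  hence "multiplicity 2 a + multiplicity 2 q = multiplicity 2 p + multiplicity 2 b"
    using assms p q by (simp add: prime_elem_multiplicity_mult_distrib)
  hence "- val2 (of_int a / of_int b) = int (multiplicity 2 b) - int (multiplicity 2 a)"
    unfolding val2_def pq by simp
  thus ?thesis using assms unfolding abs2_def by simp
qed

lemma rat_eq_quotient:
  obtains a b :: int where "(x::rat) = of_int a / of_int b" "b \<noteq> 0" "coprime a b"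
  by (metis Fract_of_int_quotient Rat_cases not_less_iff_gr_or_eq)

lemma abs2_0 [simp]: "abs2 0 = 0"
  by (simp add: abs2_def)

lemma abs2_nonneg [simp]: "abs2 x \<ge> 0"
  by (simp add: abs2_def)

lemma abs2_eq_0 [simp]: "abs2 x = 0 \<longleftrightarrow> x = 0"
  by (simp add: abs2_def)

lemma abs2_mult: "abs2 (x * y) = abs2 x * abs2 y"
proof (cases "x = 0 \<or> y = 0")
  case False
  obtain a b where x: "x = of_int a / of_int b" "b \<noteq> 0" by (rule rat_eq_quotient)
  obtain c d where y: "y = of_int c / of_int d" "d \<noteq> 0" by (rule rat_eq_quotient)
  have ac: "a \<noteq> 0" "c \<noteq> 0" using False x y by auto
  have "x * y = of_int (a * c) / of_int (b * d)" by (simp add: x y)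
  hence "abs2 (x * y) = 2 powi (int (multiplicity 2 (b * d)) - int (multiplicity 2 (a * c)))"
    using abs2_quotient[of "a * c" "b * d"] ac x y by simp
  thus ?thesis using ac x y
    by (simp add: abs2_quotient prime_elem_multiplicity_mult_distrib power_int_diff power_int_add)
qed auto

lemma abs2_1 [simp]: "abs2 1 = 1"
  using abs2_quotient[of 1 1] by simp

lemma abs2_minus [simp]: "abs2 (- x) = abs2 x"
proof -
  have "abs2 (-1) = 1" using abs2_quotient[of "-1" 1] multiplicity_times_unit_right[of "-1" 2 "1::int"]
    by simp
  thus ?thesis using abs2_mult[of "-1" x] by simp
qed

lemma abs2_minus_commute: "abs2 (x - y) = abs2 (y - x)"
  using abs2_minus[of "x - y"] by simp

lemma abs2_inverse: "abs2 (inverse x) = inverse (abs2 x)"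
proof (cases "x = 0")
  case False
  hence "abs2 x * abs2 (inverse x) = 1" by (simp flip: abs2_mult)
  thus ?thesis by (metis inverse_unique)
qed auto

lemma abs2_of_int_le_1: "abs2 (of_int a) \<le> 1"
proof (cases "a = 0")
  case False
  thus ?thesis using abs2_quotient[of a 1]
    by (simp add: power_int_def field_simps)
qed auto

lemma abs2_odd: "odd a \<Longrightarrow> abs2 (of_int a) = 1"
  using abs2_quotient[of a 1] by (cases "a = 0") (auto simp: not_dvd_imp_multiplicity_0)

lemma abs2_le_1_denom:
  assumes "abs2 x \<le> 1"
  obtains a b where "x = of_int a / of_int b" "odd b"
proof (cases "x = 0")
  case True
  thus ?thesis using that[of 0 1] by simp
next
  case False
  obtain a b where x: "x = of_int a / of_int b" "b \<noteq> 0" "coprime a b" by (rule rat_eq_quotient)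
  have a: "a \<noteq> 0" using False x by auto
  have "odd b"
  proof
    assume b: "even b"
    hence "odd a" using x by (metis coprime_common_divisor odd_one)
    hence ma: "multiplicity 2 a = 0" by (simp add: not_dvd_imp_multiplicity_0)
    have mb: "multiplicity 2 b > 0" using b x by (simp add: multiplicity_gt_zero_iff)
    have "abs2 x = 2 ^ multiplicity 2 b"
      using abs2_quotient[OF a x(2)] ma x(1) by (simp add: power_int_def)
    moreover have "(1::real) < 2 ^ multiplicity 2 b" using mb by (intro one_less_power) auto
    ultimately show False using assms by linarith
  qed
  thus ?thesis using that x by blast
qed

lemma abs2_odd_denom: "odd b \<Longrightarrow> abs2 (of_int a / of_int b) \<le> 1"
  using abs2_of_int_le_1[of a] abs2_odd[of b]
  by (simp add: divide_inverse abs2_mult abs2_inverse)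

lemma abs2_add_1:
  assumes "abs2 x \<le> 1"
  shows "abs2 (1 + x) \<le> 1"
proof -
  obtain a b where x: "x = of_int a / of_int b" and b: "odd b"
    using abs2_le_1_denom[OF assms] .
  have "1 + x = of_int (b + a) / of_int b" using b x by (cases "b = 0") (auto simp: field_simps)
  thus ?thesis using abs2_odd_denom[OF b] by metis
qed

lemma abs2_ultra: "abs2 (x + y) \<le> max (abs2 x) (abs2 y)"
proof -
  have *: "abs2 (x + y) \<le> abs2 x" if "abs2 y \<le> abs2 x" for x y
  proof (cases "x = 0")
    case False
    hence pos: "abs2 x > 0" by (simp add: order_less_le)
    have "abs2 (y / x) = abs2 y / abs2 x" by (simp add: divide_inverse abs2_mult abs2_inverse)
    hence "abs2 (y / x) \<le> 1" using that pos by simp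
    hence "abs2 (1 + y / x) \<le> 1" by (rule abs2_add_1)
    hence "abs2 x * abs2 (1 + y / x) \<le> abs2 x * 1" using pos by (intro mult_left_mono) auto
    thus ?thesis using False by (simp add: distrib_left flip: abs2_mult)
  qed (use that in auto)
  show ?thesis using *[of x y] *[of y x] by (cases "abs2 y \<le> abs2 x") (auto simp: add.commute)
qed

lemma abs2_triangle: "abs2 (x + y) \<le> abs2 x + abs2 y"
  using abs2_ultra[of x y] abs2_nonneg[of x] abs2_nonneg[of y] by linarith

lemma abs2_diff_ineq: "\<bar>abs2 x - abs2 y\<bar> \<le> abs2 (x - y)"
  using abs2_triangle[of "x - y" y] abs2_triangle[of "y - x" x] abs2_minus_commute[of x y]
  by (simp add: abs_le_iff)


section \<open>The field of 2-adic numbers\<close>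

text \<open>The 2-adic numbers are the completion of the rationals: 2-adic Cauchy sequences modulo
  2-adic null sequences.\<close>

definition null2 :: "(nat \<Rightarrow> rat) \<Rightarrow> bool" where
  "null2 X \<longleftrightarrow> (\<lambda>n. abs2 (X n)) \<longlonglongrightarrow> 0"

definition cauchy2 :: "(nat \<Rightarrow> rat) \<Rightarrow> bool" where
  "cauchy2 X \<longleftrightarrow> (\<forall>e>0. \<exists>N. \<forall>m\<ge>N. \<forall>n\<ge>N. abs2 (X m - X n) < e)"

lemma null2_squeeze:
  assumes "f \<longlonglongrightarrow> 0" "eventually (\<lambda>n. abs2 (X n) \<le> f n) sequentially"
  shows "null2 X"
  unfolding null2_def
  by (rule tendsto_sandwich[OF _ assms(2) tendsto_const assms(1)]) simp

lemma null2_const [simp]: "null2 (\<lambda>n. c) \<longleftrightarrow> c = 0"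
  unfolding null2_def by (simp add: tendsto_const_iff)

lemma null2_minus: "null2 X \<Longrightarrow> null2 (\<lambda>n. - X n)"
  unfolding null2_def by simp

lemma null2_add: "null2 X \<Longrightarrow> null2 Y \<Longrightarrow> null2 (\<lambda>n. X n + Y n)"
  by (rule null2_squeeze[where f = "\<lambda>n. abs2 (X n) + abs2 (Y n)"])
    (auto simp: null2_def abs2_triangle intro: tendsto_add_zero)

lemma null2_diff: "null2 X \<Longrightarrow> null2 Y \<Longrightarrow> null2 (\<lambda>n. X n - Y n)"
  using null2_add[of X "\<lambda>n. - Y n"] null2_minus[of Y] by simp

lemma cauchy2D: "cauchy2 X \<Longrightarrow> e > 0 \<Longrightarrow> \<exists>N. \<forall>m\<ge>N. \<forall>n\<ge>N. abs2 (X m - X n) < e"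
  unfolding cauchy2_def by blast

lemma cauchy2_const [simp]: "cauchy2 (\<lambda>n. c)"
  unfolding cauchy2_def by simp

lemma cauchy2_abs2_convergent:
  assumes "cauchy2 X"
  shows "convergent (\<lambda>n. abs2 (X n))"
proof -
  have "Cauchy (\<lambda>n. abs2 (X n))"
    unfolding Cauchy_def dist_real_def
    using assms abs2_diff_ineq unfolding cauchy2_def by (meson le_less_trans)
  thus ?thesis by (simp add: Cauchy_convergent)
qed

lemma cauchy2_bounded:
  assumes "cauchy2 X"
  obtains b where "b > 0" "\<And>n. abs2 (X n) \<le> b"
proof -
  have "Bseq (\<lambda>n. abs2 (X n))"
    using cauchy2_abs2_convergent[OF assms] by (rule convergent_imp_Bseq)
  thus ?thesis using that unfolding Bseq_def by auto
qed

lemma cauchy2_add [simp]: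
  assumes "cauchy2 X" "cauchy2 Y"
  shows "cauchy2 (\<lambda>n. X n + Y n)"
  unfolding cauchy2_def
proof (intro allI impI)
  fix e :: real assume e: "e > 0"
  obtain M where M: "\<forall>m\<ge>M. \<forall>n\<ge>M. abs2 (X m - X n) < e" using cauchy2D[OF assms(1) e] ..
  obtain N where N: "\<forall>m\<ge>N. \<forall>n\<ge>N. abs2 (Y m - Y n) < e" using cauchy2D[OF assms(2) e] ..
  have "abs2 (X m + Y m - (X n + Y n)) < e" if "m \<ge> max M N" "n \<ge> max M N" for m n
    using abs2_ultra[of "X m - X n" "Y m - Y n"] M[rule_format, of m n] N[rule_format, of m n] that
    by (simp add: add_diff_add)
  thus "\<exists>N. \<forall>m\<ge>N. \<forall>n\<ge>N. abs2 (X m + Y m - (X n + Y n)) < e" by blast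
qed

lemma cauchy2_minus [simp]: "cauchy2 X \<Longrightarrow> cauchy2 (\<lambda>n. - X n)"
  unfolding cauchy2_def minus_diff_minus abs2_minus .

lemma cauchy2_diff [simp]: "cauchy2 X \<Longrightarrow> cauchy2 Y \<Longrightarrow> cauchy2 (\<lambda>n. X n - Y n)"
  using cauchy2_add[of X "\<lambda>n. - Y n"] cauchy2_minus[of Y] by simp

lemma cauchy2_mult [simp]:
  assumes "cauchy2 X" "cauchy2 Y"
  shows "cauchy2 (\<lambda>n. X n * Y n)"
  unfolding cauchy2_def
proof (intro allI impI)
  fix e :: real assume e: "e > 0"
  obtain a where a: "a > 0" "\<And>n. abs2 (X n) \<le> a" using cauchy2_bounded[OF assms(1)] by blast
  obtain b where b: "b > 0" "\<And>n. abs2 (Y n) \<le> b" using cauchy2_bounded[OF assms(2)] by blast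
  obtain M where M: "\<forall>m\<ge>M. \<forall>n\<ge>M. abs2 (X m - X n) < e / b"
    using cauchy2D[OF assms(1), of "e / b"] e b by auto
  obtain N where N: "\<forall>m\<ge>N. \<forall>n\<ge>N. abs2 (Y m - Y n) < e / a"
    using cauchy2D[OF assms(2), of "e / a"] e a by auto
  have "abs2 (X m * Y m - X n * Y n) < e" if mn: "m \<ge> max M N" "n \<ge> max M N" for m n
  proof -
    have "abs2 (X m) * abs2 (Y m - Y n) \<le> a * abs2 (Y m - Y n)"
      using a by (intro mult_right_mono) auto
    also have "\<dots> < e" using N[rule_format, of m n] mn a by (simp add: field_simps)
    finally have 1: "abs2 (X m * (Y m - Y n)) < e" by (simp add: abs2_mult)
    have "abs2 (X m - X n) * abs2 (Y n) \<le> abs2 (X m - X n) * b"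
      using b by (intro mult_left_mono) auto
    also have "\<dots> < e" using M[rule_format, of m n] mn b by (simp add: field_simps)
    finally have 2: "abs2 ((X m - X n) * Y n) < e" by (simp add: abs2_mult)
    show ?thesis unfolding mult_diff_mult
      using abs2_ultra[of "X m * (Y m - Y n)" "(X m - X n) * Y n"] 1 2 by linarith
  qed
  thus "\<exists>N. \<forall>m\<ge>N. \<forall>n\<ge>N. abs2 (X m * Y m - X n * Y n) < e" by blast
qed

lemma null2_mult:
  assumes "cauchy2 X" "null2 Y"
  shows "null2 (\<lambda>n. X n * Y n)"
proof -
  obtain a where a: "a > 0" "\<And>n. abs2 (X n) \<le> a" using cauchy2_bounded[OF assms(1)] by blast
  show ?thesis
  proof (rule null2_squeeze)
    show "(\<lambda>n. a * abs2 (Y n)) \<longlonglongrightarrow> 0"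
      using tendsto_mult_right_zero assms(2) unfolding null2_def by blast
  qed (use a in \<open>auto simp: abs2_mult mult_right_mono\<close>)
qed

lemma cauchy2_not_null2:
  assumes "cauchy2 X" "\<not> null2 X"
  obtains b N where "b > 0" "\<And>n. n \<ge> N \<Longrightarrow> abs2 (X n) > b"
proof -
  obtain L where L: "(\<lambda>n. abs2 (X n)) \<longlonglongrightarrow> L"
    using cauchy2_abs2_convergent[OF assms(1)] unfolding convergent_def ..
  have "L \<ge> 0" by (rule LIMSEQ_le_const[OF L]) auto
  moreover have "L \<noteq> 0" using L assms(2) unfolding null2_def by auto
  ultimately have "L > 0" by simp
  hence "eventually (\<lambda>n. abs2 (X n) > L / 2) sequentially"
    using order_tendstoD(1)[OF L, of "L / 2"] by simp
  thus ?thesis using that[of "L / 2"] \<open>L > 0\<close> unfolding eventually_sequentially by auto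
qed

lemma abs2_inverse_diff:
  assumes "abs2 x > a" "abs2 y > b" "a > 0" "b > 0"
  shows "abs2 (inverse x - inverse y) \<le> abs2 (x - y) / (a * b)"
proof -
  have nz: "x \<noteq> 0" "y \<noteq> 0" using assms by auto
  have "abs2 (inverse x - inverse y) = abs2 (x - y) / (abs2 x * abs2 y)"
    unfolding inverse_diff_inverse[OF nz] abs2_minus abs2_mult abs2_inverse
    by (simp add: divide_inverse)
  also have "\<dots> \<le> abs2 (x - y) / (a * b)"
    using assms by (intro divide_left_mono mult_mono mult_pos_pos) auto
  finally show ?thesis .
qed

lemma cauchy2_inverse [simp]:
  assumes "cauchy2 X" "\<not> null2 X"
  shows "cauchy2 (\<lambda>n. inverse (X n))"
  unfolding cauchy2_def
proof (intro allI impI)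
  fix e :: real assume e: "e > 0"
  obtain b M where b: "b > 0" "\<And>n. n \<ge> M \<Longrightarrow> abs2 (X n) > b"
    using cauchy2_not_null2[OF assms] by blast
  obtain N where N: "\<forall>m\<ge>N. \<forall>n\<ge>N. abs2 (X m - X n) < e * (b * b)"
    using cauchy2D[OF assms(1), of "e * (b * b)"] e b by auto
  have "abs2 (inverse (X m) - inverse (X n)) < e" if mn: "m \<ge> max M N" "n \<ge> max M N" for m n
  proof -
    have "abs2 (inverse (X m) - inverse (X n)) \<le> abs2 (X m - X n) / (b * b)"
      using abs2_inverse_diff b mn by auto
    also have "\<dots> < e" using N[rule_format, of m n] mn b by (simp add: field_simps)
    finally show ?thesis .
  qed
  thus "\<exists>N. \<forall>m\<ge>N. \<forall>n\<ge>N. abs2 (inverse (X m) - inverse (X n)) < e" by blast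
qed

lemma null2_diff_inverse:
  assumes X: "cauchy2 X" "\<not> null2 X" and Y: "cauchy2 Y" "\<not> null2 Y"
    and XY: "null2 (\<lambda>n. X n - Y n)"
  shows "null2 (\<lambda>n. inverse (X n) - inverse (Y n))"
proof -
  obtain a M where a: "a > 0" "\<And>n. n \<ge> M \<Longrightarrow> abs2 (X n) > a"
    using cauchy2_not_null2[OF X] by blast
  obtain b N where b: "b > 0" "\<And>n. n \<ge> N \<Longrightarrow> abs2 (Y n) > b"
    using cauchy2_not_null2[OF Y] by blast
  show ?thesis
  proof (rule null2_squeeze)
    show "(\<lambda>n. abs2 (X n - Y n) / (a * b)) \<longlonglongrightarrow> 0"
      using tendsto_divide_zero XY unfolding null2_def by blast
    show "eventually (\<lambda>n. abs2 (inverse (X n) - inverse (Y n)) \<le> abs2 (X n - Y n) / (a * b))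
      sequentially"
      using eventually_ge_at_top[of "max M N"]
      by eventually_elim (use a b abs2_inverse_diff in auto)
  qed
qed

definition q2rel :: "(nat \<Rightarrow> rat) \<Rightarrow> (nat \<Rightarrow> rat) \<Rightarrow> bool" where
  "q2rel X Y \<longleftrightarrow> cauchy2 X \<and> cauchy2 Y \<and> null2 (\<lambda>n. X n - Y n)"

lemma part_equivp_q2rel: "part_equivp q2rel"
proof (rule part_equivpI)
  show "\<exists>X. q2rel X X" by (rule exI[of _ "\<lambda>_. 0"]) (simp add: q2rel_def)
  show "symp q2rel"
    by (auto simp: symp_def q2rel_def null2_def abs2_minus_commute)
  show "transp q2rel"
  proof (rule transpI)
    fix X Y Z assume "q2rel X Y" "q2rel Y Z"
    thus "q2rel X Z"
      using null2_add[of "\<lambda>n. X n - Y n" "\<lambda>n. Y n - Z n"] by (simp add: q2rel_def)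
  qed
qed

quotient_type q2 = "nat \<Rightarrow> rat" / partial: q2rel
  morphisms rep_q2 Q2
  by (rule part_equivp_q2rel)

lemma Domainp_pcr_q2 [transfer_domain_rule]: "Domainp pcr_q2 = cauchy2"
  by (simp add: q2.domain_eq q2rel_def)

instantiation q2 :: field
begin

lift_definition zero_q2 :: "q2" is "\<lambda>n. 0"
  by (simp add: q2rel_def)

lift_definition one_q2 :: "q2" is "\<lambda>n. 1"
  by (simp add: q2rel_def)

lift_definition plus_q2 :: "q2 \<Rightarrow> q2 \<Rightarrow> q2" is "\<lambda>X Y n. X n + Y n"
  unfolding q2rel_def add_diff_add by (simp only: cauchy2_add null2_add simp_thms)

lift_definition uminus_q2 :: "q2 \<Rightarrow> q2" is "\<lambda>X n. - X n"
  unfolding q2rel_def minus_diff_minus by (simp only: cauchy2_minus null2_minus simp_thms)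

lift_definition times_q2 :: "q2 \<Rightarrow> q2 \<Rightarrow> q2" is "\<lambda>X Y n. X n * Y n"
proof -
  fix X X' Y Y' assume "q2rel X X'" "q2rel Y Y'"
  hence c: "cauchy2 X" "cauchy2 X'" "cauchy2 Y" "cauchy2 Y'"
    and d: "null2 (\<lambda>n. X n - X' n)" "null2 (\<lambda>n. Y n - Y' n)" by (auto simp: q2rel_def)
  have "null2 (\<lambda>n. X n * (Y n - Y' n) + Y' n * (X n - X' n))"
    by (intro null2_add null2_mult c d)
  also have "(\<lambda>n. X n * (Y n - Y' n) + Y' n * (X n - X' n)) = (\<lambda>n. X n * Y n - X' n * Y' n)"
    by (simp add: algebra_simps)
  finally show "q2rel (\<lambda>n. X n * Y n) (\<lambda>n. X' n * Y' n)" using c by (simp add: q2rel_def)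
qed

lift_definition inverse_q2 :: "q2 \<Rightarrow> q2"
  is "\<lambda>X. if null2 X then (\<lambda>n. 0) else (\<lambda>n. inverse (X n))"
proof -
  fix X Y assume "q2rel X Y"
  hence c: "cauchy2 X" "cauchy2 Y" and d: "null2 (\<lambda>n. X n - Y n)" by (auto simp: q2rel_def)
  have "null2 X \<longleftrightarrow> null2 Y"
    using null2_diff[OF _ d] null2_add[OF _ d] by fastforce
  thus "q2rel (if null2 X then (\<lambda>n. 0) else (\<lambda>n. inverse (X n)))
              (if null2 Y then (\<lambda>n. 0) else (\<lambda>n. inverse (Y n)))"
    using c d by (simp add: q2rel_def null2_diff_inverse)
qed

definition "x - y = x + - y" for x y :: q2

definition "x div y = x * inverse y" for x y :: q2

instance
proof
  fix a b c :: q2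
  show "a + b = b + a" by transfer (simp add: ac_simps q2rel_def)
  show "(a + b) + c = a + (b + c)" by transfer (simp add: ac_simps q2rel_def)
  show "0 + a = a" by transfer (simp add: q2rel_def)
  show "- a + a = 0" by transfer (simp add: q2rel_def)
  show "a - b = a + - b" by (rule minus_q2_def)
  show "(a * b) * c = a * (b * c)" by transfer (simp add: ac_simps q2rel_def)
  show "a * b = b * a" by transfer (simp add: ac_simps q2rel_def)
  show "1 * a = a" by transfer (simp add: q2rel_def)
  show "(a + b) * c = a * c + b * c" by transfer (simp add: distrib_right q2rel_def)
  show "(0::q2) \<noteq> 1" by transfer (simp add: q2rel_def)
  have "null2 (\<lambda>n. inverse (X n) * X n - 1)" if X: "cauchy2 X" "\<not> null2 X" for X
  proof -
    obtain b N where b: "b > 0" "\<And>n. n \<ge> N \<Longrightarrow> abs2 (X n) > b"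
      using cauchy2_not_null2[OF X] by blast
    show ?thesis
    proof (rule null2_squeeze[OF tendsto_const])
      show "eventually (\<lambda>n. abs2 (inverse (X n) * X n - 1) \<le> 0) sequentially"
        using eventually_ge_at_top[of N]
      proof eventually_elim
        case (elim n)
        hence "X n \<noteq> 0" using b(1) b(2)[of n] by auto
        thus ?case by simp
      qed
    qed
  qed
  thus "a \<noteq> 0 \<Longrightarrow> inverse a * a = 1" by transfer (simp add: q2rel_def)
  show "a div b = a * inverse b" by (rule divide_q2_def)
  show "inverse (0::q2) = 0" by transfer (simp add: q2rel_def)
qed

end

text \<open>The extension of the 2-adic absolute value by continuity.\<close>

lift_definition abs_q2 :: "q2 \<Rightarrow> real" is "\<lambda>X. lim (\<lambda>n. abs2 (X n))"
proof -
  fix X Y assume "q2rel X Y"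
  hence c: "cauchy2 X" "cauchy2 Y" and d: "(\<lambda>n. abs2 (X n - Y n)) \<longlonglongrightarrow> 0"
    by (auto simp: q2rel_def null2_def)
  have X: "(\<lambda>n. abs2 (X n)) \<longlonglongrightarrow> lim (\<lambda>n. abs2 (X n))"
    using cauchy2_abs2_convergent[OF c(1)] by (simp add: convergent_LIMSEQ_iff)
  have "(\<lambda>n. abs2 (Y n) - abs2 (X n)) \<longlonglongrightarrow> 0"
  proof (rule tendsto_rabs_zero_cancel, rule tendsto_sandwich[OF _ _ tendsto_const d])
    show "\<forall>\<^sub>F n in sequentially. \<bar>abs2 (Y n) - abs2 (X n)\<bar> \<le> abs2 (X n - Y n)"
      using abs2_diff_ineq by (simp add: abs2_minus_commute[of "X _"])
  qed simp
  from tendsto_add[OF this X] have "(\<lambda>n. abs2 (Y n)) \<longlonglongrightarrow> lim (\<lambda>n. abs2 (X n))" by simp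
  thus "lim (\<lambda>n. abs2 (X n)) = lim (\<lambda>n. abs2 (Y n))" by (simp add: limI)
qed

lemma Q2_eqI:
  assumes "cauchy2 X" "cauchy2 Y"
  shows "Q2 X = Q2 Y \<longleftrightarrow> null2 (\<lambda>n. X n - Y n)"
  using assms q2.rel_eq_transfer
  unfolding q2.pcr_cr_eq cr_q2_def rel_fun_def q2rel_def by simp

lemma of_nat_q2: "of_nat k = Q2 (\<lambda>n. of_nat k)"
proof (induct k)
  case 0
  show ?case by (simp add: zero_q2_def)
next
  case (Suc k)
  have "of_nat (Suc k) = 1 + Q2 (\<lambda>n. of_nat k)" using Suc by simp
  also have "\<dots> = Q2 (\<lambda>n. 1 + of_nat k)"
    unfolding one_q2_def by (rule plus_q2.abs_eq) (simp_all add: q2rel_def)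
  finally show ?case by simp
qed

instance q2 :: field_char_0
proof
  show "inj (of_nat :: nat \<Rightarrow> q2)"
    by (rule injI) (simp add: of_nat_q2 Q2_eqI)
qed

lemma lim_abs2: "cauchy2 X \<Longrightarrow> (\<lambda>n. abs2 (X n)) \<longlonglongrightarrow> lim (\<lambda>n. abs2 (X n))"
  using cauchy2_abs2_convergent by (simp add: convergent_LIMSEQ_iff)

lemma abs_q2_nonneg [simp]: "abs_q2 x \<ge> 0"
  by transfer (rule LIMSEQ_le_const[OF lim_abs2], simp_all)

lemma abs_q2_eq_0 [simp]: "abs_q2 x = 0 \<longleftrightarrow> x = 0"
proof transfer
  fix X assume X: "cauchy2 X"
  have "lim (\<lambda>n. abs2 (X n)) = 0 \<longleftrightarrow> null2 X"
    unfolding null2_def using lim_abs2[OF X] by (metis limI)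
  thus "(lim (\<lambda>n. abs2 (X n)) = 0) = q2rel X (\<lambda>n. 0)" using X by (simp add: q2rel_def)
qed

lemma abs_q2_0 [simp]: "abs_q2 0 = 0"
  by simp

lemma abs_q2_1 [simp]: "abs_q2 1 = 1"
  by transfer simp

lemma abs_q2_mult: "abs_q2 (x * y) = abs_q2 x * abs_q2 y"
proof transfer
  fix X Y assume "cauchy2 X" "cauchy2 Y"
  from tendsto_mult[OF this[THEN lim_abs2]]
  show "lim (\<lambda>n. abs2 (X n * Y n)) = lim (\<lambda>n. abs2 (X n)) * lim (\<lambda>n. abs2 (Y n))"
    by (simp add: abs2_mult limI)
qed

lemma abs_q2_minus [simp]: "abs_q2 (- x) = abs_q2 x"
  by transfer simp

lemma abs_q2_ultra: "abs_q2 (x + y) \<le> max (abs_q2 x) (abs_q2 y)"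
proof transfer
  fix X Y assume c: "cauchy2 X" "cauchy2 Y"
  show "lim (\<lambda>n. abs2 (X n + Y n)) \<le> max (lim (\<lambda>n. abs2 (X n))) (lim (\<lambda>n. abs2 (Y n)))"
  proof (rule LIMSEQ_le)
    show "(\<lambda>n. abs2 (X n + Y n)) \<longlonglongrightarrow> lim (\<lambda>n. abs2 (X n + Y n))"
      by (rule lim_abs2) (use c in simp)
    show "(\<lambda>n. max (abs2 (X n)) (abs2 (Y n)))
      \<longlonglongrightarrow> max (lim (\<lambda>n. abs2 (X n))) (lim (\<lambda>n. abs2 (Y n)))"
      by (intro tendsto_max lim_abs2 c)
  qed (use abs2_ultra in auto)
qed

lemma abs2_less_2: "abs2 x < 2 \<Longrightarrow> abs2 x \<le> 1"
proof -
  assume *: "abs2 x < 2"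
  show ?thesis
  proof (cases "x = 0")
    case False
    have "- val2 x < 1"
    proof (rule ccontr)
      assume "\<not> - val2 x < 1"
      hence "(2::real) powi 1 \<le> 2 powi (- val2 x)" by (intro power_int_increasing) auto
      thus False using * False by (simp add: abs2_def)
    qed
    hence "(2::real) powi (- val2 x) \<le> 2 powi 0" by (intro power_int_increasing) auto
    thus ?thesis by (simp add: abs2_def)
  qed auto
qed

lemma abs_q2_less_2: "abs_q2 x < 2 \<Longrightarrow> abs_q2 x \<le> 1"
proof transfer
  fix X assume X: "cauchy2 X" and *: "lim (\<lambda>n. abs2 (X n)) < 2"
  have "eventually (\<lambda>n. abs2 (X n) \<le> 1) sequentially"
    using order_tendstoD(2)[OF lim_abs2[OF X] *] by eventually_elim (rule abs2_less_2)
  thus "lim (\<lambda>n. abs2 (X n)) \<le> 1"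
    using tendsto_upperbound[OF lim_abs2[OF X]] by simp
qed

definition Z2 :: "q2 set" where
  "Z2 = {x. abs_q2 x \<le> 1}"


section \<open>The quadratic extension of the 2-adic numbers by a square root of 3\<close>

text \<open>That 3 is not a square in the 2-adic numbers comes from an estimate
  for the norm form \<open>x\<^sup>2 - 3 y\<^sup>2\<close>, first over the rationals.\<close>

lemma abs2_not_4_dvd:
  assumes "\<not> 4 dvd n"
  shows "abs2 (of_int n) \<ge> 1 / 2"
proof -
  have n: "n \<noteq> 0" using assms by auto
  have "multiplicity 2 n < 2"
    by (rule multiplicity_lessI) (use n assms in auto)
  hence "multiplicity 2 n = 0 \<or> multiplicity 2 n = 1" by auto
  thus ?thesis using abs2_quotient[of n 1] n by (auto simp: power_int_minus)
qed

lemma not_4_dvd_norm_form: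
  fixes a b :: int
  assumes "odd a \<or> odd b"
  shows "\<not> 4 dvd a\<^sup>2 - 3 * b\<^sup>2"
proof -
  have sq: "(4::int) dvd x\<^sup>2 \<or> 4 dvd x\<^sup>2 - 1" for x
  proof (cases "even x")
    case True
    then obtain k where "x = 2 * k" by blast
    thus ?thesis by (simp add: power2_eq_square)
  next
    case False
    then obtain k where "x = 2 * k + 1" by (blast elim: oddE)
    hence "x\<^sup>2 - 1 = 4 * (k\<^sup>2 + k)" by (simp add: power2_eq_square algebra_simps)
    thus ?thesis by simp
  qed
  have *: "\<not> 4 dvd A - 3 * B"
    if "odd A \<or> odd B" "4 dvd A \<or> 4 dvd A - 1" "4 dvd B \<or> 4 dvd B - 1" for A B :: int
    using that by presburger
  show ?thesis by (rule *) (use assms sq in auto)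
qed

lemma abs2_norm_form_1:
  assumes "abs2 t \<le> 1"
  shows "abs2 (1 - 3 * t\<^sup>2) \<ge> 1 / 2" "abs2 (t\<^sup>2 - 3) \<ge> 1 / 2"
proof -
  obtain a b where t: "t = of_int a / of_int b" and b: "odd b"
    using abs2_le_1_denom[OF assms] .
  have b0: "b \<noteq> 0" using b by auto
  have bb: "abs2 ((of_int b)\<^sup>2) = 1" using abs2_odd[OF b] by (simp add: power2_eq_square abs2_mult)
  have "abs2 (1 - 3 * t\<^sup>2) = abs2 ((of_int b)\<^sup>2 * (1 - 3 * t\<^sup>2))" using bb by (simp add: abs2_mult)
  also have "(of_int b)\<^sup>2 * (1 - 3 * t\<^sup>2) = of_int (b\<^sup>2 - 3 * a\<^sup>2)"
    using b0 by (simp add: t field_simps)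
  finally show "abs2 (1 - 3 * t\<^sup>2) \<ge> 1 / 2"
    using abs2_not_4_dvd[OF not_4_dvd_norm_form] b by metis
  have "abs2 (t\<^sup>2 - 3) = abs2 ((of_int b)\<^sup>2 * (t\<^sup>2 - 3))" using bb by (simp add: abs2_mult)
  also have "(of_int b)\<^sup>2 * (t\<^sup>2 - 3) = of_int (a\<^sup>2 - 3 * b\<^sup>2)"
    using b0 by (simp add: t field_simps)
  finally show "abs2 (t\<^sup>2 - 3) \<ge> 1 / 2"
    using abs2_not_4_dvd[OF not_4_dvd_norm_form] b by metis
qed

lemma abs2_norm_form:
  "(max (abs2 x) (abs2 y))\<^sup>2 / 2 \<le> abs2 (x\<^sup>2 - 3 * y\<^sup>2)"
proof (cases "abs2 y \<le> abs2 x")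
  case le: True
  show ?thesis
  proof (cases "x = 0")
    case False
    have "abs2 (y / x) = abs2 y / abs2 x" by (simp add: divide_inverse abs2_mult abs2_inverse)
    hence "abs2 (y / x) \<le> 1" using le False by (simp add: divide_le_eq_1 order_less_le)
    from abs2_norm_form_1(1)[OF this]
    have "(abs2 x)\<^sup>2 * (1 / 2) \<le> (abs2 x)\<^sup>2 * abs2 (1 - 3 * (y / x)\<^sup>2)"
      by (intro mult_left_mono) auto
    also have "\<dots> = abs2 (x\<^sup>2 * (1 - 3 * (y / x)\<^sup>2))"
      by (simp add: power2_eq_square abs2_mult)
    also have "x\<^sup>2 * (1 - 3 * (y / x)\<^sup>2) = x\<^sup>2 - 3 * y\<^sup>2" using False by (simp add: field_simps)
    finally show ?thesis using le by simp
  qed (use le in auto)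
next
  case gt: False
  hence y: "y \<noteq> 0" by auto
  have "abs2 (x / y) = abs2 x / abs2 y" by (simp add: divide_inverse abs2_mult abs2_inverse)
  hence "abs2 (x / y) \<le> 1" using gt y by (simp add: divide_le_eq_1 order_less_le)
  from abs2_norm_form_1(2)[OF this]
  have "(abs2 y)\<^sup>2 * (1 / 2) \<le> (abs2 y)\<^sup>2 * abs2 ((x / y)\<^sup>2 - 3)"
    by (intro mult_left_mono) auto
  also have "\<dots> = abs2 (y\<^sup>2 * ((x / y)\<^sup>2 - 3))"
    by (simp add: power2_eq_square abs2_mult)
  also have "y\<^sup>2 * ((x / y)\<^sup>2 - 3) = x\<^sup>2 - 3 * y\<^sup>2" using y by (simp add: field_simps)
  finally show ?thesis using gt by simp
qed

lemma abs_q2_norm_form: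
  "(max (abs_q2 x) (abs_q2 y))\<^sup>2 / 2 \<le> abs_q2 (x * x - (1 + 1 + 1) * (y * y))"
  unfolding minus_q2_def
proof transfer
  fix X Y assume c: "cauchy2 X" "cauchy2 Y"
  let ?F = "\<lambda>n. X n * X n + - ((1 + 1 + 1) * (Y n * Y n))"
  show "(max (lim (\<lambda>n. abs2 (X n))) (lim (\<lambda>n. abs2 (Y n))))\<^sup>2 / 2 \<le> lim (\<lambda>n. abs2 (?F n))"
  proof (rule LIMSEQ_le)
    show "(\<lambda>n. abs2 (?F n)) \<longlonglongrightarrow> lim (\<lambda>n. abs2 (?F n))"
      by (intro lim_abs2 cauchy2_add cauchy2_minus cauchy2_mult cauchy2_const c)
    show "(\<lambda>n. (max (abs2 (X n)) (abs2 (Y n)))\<^sup>2 / 2)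
      \<longlonglongrightarrow> (max (lim (\<lambda>n. abs2 (X n))) (lim (\<lambda>n. abs2 (Y n))))\<^sup>2 / 2"
      by (intro tendsto_intros tendsto_max lim_abs2 c) auto
    show "\<exists>N. \<forall>n\<ge>N. (max (abs2 (X n)) (abs2 (Y n)))\<^sup>2 / 2 \<le> abs2 (?F n)"
      using abs2_norm_form by (auto simp: power2_eq_square)
  qed
qed

text \<open>\<open>Q2_Sqrt3 a b\<close> stands for \<open>a + b \<surd>3\<close>.\<close>

datatype q2_sqrt3 = Q2_Sqrt3 (coeff_1: q2) (coeff_sqrt3: q2)

definition field_norm :: "q2_sqrt3 \<Rightarrow> q2" where
  "field_norm x = (coeff_1 x)\<^sup>2 - 3 * (coeff_sqrt3 x)\<^sup>2"

lemma field_norm_bound: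
  "(max (abs_q2 (coeff_1 x)) (abs_q2 (coeff_sqrt3 x)))\<^sup>2 / 2 \<le> abs_q2 (field_norm x)"
  using abs_q2_norm_form by (simp add: field_norm_def power2_eq_square)

lemma field_norm_eq_0: "field_norm x = 0 \<longleftrightarrow> coeff_1 x = 0 \<and> coeff_sqrt3 x = 0"
proof
  assume "field_norm x = 0"
  hence "max (abs_q2 (coeff_1 x)) (abs_q2 (coeff_sqrt3 x)) = 0" using field_norm_bound[of x] by simp
  thus "coeff_1 x = 0 \<and> coeff_sqrt3 x = 0"
    by (metis abs_q2_eq_0 abs_q2_nonneg max.cobounded1 max.cobounded2 order_antisym)
qed (simp add: field_norm_def)

instantiation q2_sqrt3 :: field
begin

definition "0 = Q2_Sqrt3 0 0"

definition "1 = Q2_Sqrt3 1 0"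

definition "x + y = Q2_Sqrt3 (coeff_1 x + coeff_1 y) (coeff_sqrt3 x + coeff_sqrt3 y)"

definition "- x = Q2_Sqrt3 (- coeff_1 x) (- coeff_sqrt3 x)"

definition "x - y = Q2_Sqrt3 (coeff_1 x - coeff_1 y) (coeff_sqrt3 x - coeff_sqrt3 y)"

definition "x * y = Q2_Sqrt3
  (coeff_1 x * coeff_1 y + 3 * (coeff_sqrt3 x * coeff_sqrt3 y))
  (coeff_1 x * coeff_sqrt3 y + coeff_sqrt3 x * coeff_1 y)"

definition "inverse x = Q2_Sqrt3 (coeff_1 x / field_norm x) (- coeff_sqrt3 x / field_norm x)"

definition "x div y = x * inverse y" for x y :: q2_sqrt3

instance
proof
  fix a b c :: q2_sqrt3
  note defs = zero_q2_sqrt3_def one_q2_sqrt3_def plus_q2_sqrt3_def uminus_q2_sqrt3_def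
    minus_q2_sqrt3_def times_q2_sqrt3_def
  show "a + b = b + a" "(a + b) + c = a + (b + c)" "0 + a = a" "- a + a = 0" "a - b = a + - b"
    "(a * b) * c = a * (b * c)" "a * b = b * a" "1 * a = a" "(a + b) * c = a * c + b * c"
    "(0::q2_sqrt3) \<noteq> 1"
    by (simp_all add: defs algebra_simps)
  show "a div b = a * inverse b" by (rule divide_q2_sqrt3_def)
  show "inverse (0::q2_sqrt3) = 0" by (simp add: inverse_q2_sqrt3_def zero_q2_sqrt3_def)
  show "inverse a * a = 1" if "a \<noteq> 0"
  proof -
    have nz: "field_norm a \<noteq> 0"
      using that field_norm_eq_0[of a] by (cases a) (auto simp: zero_q2_sqrt3_def)
    have "coeff_1 a / field_norm a * coeff_1 a
        + 3 * (- coeff_sqrt3 a / field_norm a * coeff_sqrt3 a)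
      = ((coeff_1 a)\<^sup>2 - 3 * (coeff_sqrt3 a)\<^sup>2) / field_norm a"
      by (simp add: diff_divide_distrib power2_eq_square)
    also have "\<dots> = field_norm a / field_norm a" by (simp only: field_norm_def)
    also have "\<dots> = 1" using nz by simp
    finally show ?thesis
      by (simp add: inverse_q2_sqrt3_def times_q2_sqrt3_def one_q2_sqrt3_def)
  qed
qed

end

lemma of_nat_q2_sqrt3: "of_nat n = Q2_Sqrt3 (of_nat n) 0"
  by (induct n) (simp_all add: zero_q2_sqrt3_def one_q2_sqrt3_def plus_q2_sqrt3_def)

instance q2_sqrt3 :: field_char_0
  by standard (auto simp: inj_def of_nat_q2_sqrt3)

definition sqrt3 :: q2_sqrt3 where
  "sqrt3 = Q2_Sqrt3 0 1"

lemma sqrt3_square: "sqrt3 ^ 2 = 3"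
  using of_nat_q2_sqrt3[of 3] by (simp add: power2_eq_square sqrt3_def times_q2_sqrt3_def)

text \<open>The unique extension of the 2-adic absolute value: \<open>\<bar>x\<bar> = \<bar>N(x)\<bar>\<^sup>1\<^sup>/\<^sup>2\<close>.\<close>

definition abs_q2_sqrt3 :: "q2_sqrt3 \<Rightarrow> real" where
  "abs_q2_sqrt3 x = sqrt (abs_q2 (field_norm x))"

lemma abs_q2_sqrt3_nonneg [simp]: "abs_q2_sqrt3 x \<ge> 0"
  by (simp add: abs_q2_sqrt3_def)

lemma abs_q2_sqrt3_eq_0 [simp]: "abs_q2_sqrt3 x = 0 \<longleftrightarrow> x = 0"
  by (cases x) (simp add: abs_q2_sqrt3_def field_norm_eq_0 zero_q2_sqrt3_def)

lemma field_norm_mult: "field_norm (x * y) = field_norm x * field_norm y"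
  by (simp add: field_norm_def times_q2_sqrt3_def power2_eq_square algebra_simps)

lemma abs_q2_sqrt3_mult: "abs_q2_sqrt3 (x * y) = abs_q2_sqrt3 x * abs_q2_sqrt3 y"
  by (simp add: abs_q2_sqrt3_def field_norm_mult abs_q2_mult real_sqrt_mult)

lemma abs_q2_sqrt3_minus [simp]: "abs_q2_sqrt3 (- x) = abs_q2_sqrt3 x"
  by (simp add: abs_q2_sqrt3_def field_norm_def uminus_q2_sqrt3_def)

lemma abs_q2_sqrt3_of_q2: "abs_q2_sqrt3 (Q2_Sqrt3 x 0) = abs_q2 x"
  by (simp add: abs_q2_sqrt3_def field_norm_def power2_eq_square abs_q2_mult)

lemma abs_q2_sqrt3_le_1_iff:
  "abs_q2_sqrt3 x \<le> 1 \<longleftrightarrow> abs_q2 (coeff_1 x) \<le> 1 \<and> abs_q2 (coeff_sqrt3 x) \<le> 1"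
proof
  assume "abs_q2_sqrt3 x \<le> 1"
  hence "abs_q2 (field_norm x) \<le> 1" by (simp add: abs_q2_sqrt3_def)
  hence *: "(max (abs_q2 (coeff_1 x)) (abs_q2 (coeff_sqrt3 x)))\<^sup>2 \<le> 2"
    using field_norm_bound[of x] by simp
  have "max (abs_q2 (coeff_1 x)) (abs_q2 (coeff_sqrt3 x)) < 2"
    by (rule power2_less_imp_less) (use * in auto)
  thus "abs_q2 (coeff_1 x) \<le> 1 \<and> abs_q2 (coeff_sqrt3 x) \<le> 1" using abs_q2_less_2 by simp
next
  assume *: "abs_q2 (coeff_1 x) \<le> 1 \<and> abs_q2 (coeff_sqrt3 x) \<le> 1"
  have "abs_q2 (1 + (1 + 1)) \<le> 1" using abs_q2_ultra[of 1 "1 + 1"] abs_q2_ultra[of 1 1] by simp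
  hence 3: "abs_q2 3 \<le> 1" by simp
  have "abs_q2 ((coeff_1 x)\<^sup>2) \<le> 1"
    using * by (simp add: power2_eq_square abs_q2_mult mult_le_one)
  moreover have "abs_q2 (- (3 * (coeff_sqrt3 x)\<^sup>2)) \<le> 1"
    using * 3 by (simp add: power2_eq_square abs_q2_mult mult_le_one)
  ultimately have "abs_q2 (field_norm x) \<le> 1"
    using abs_q2_ultra[of "(coeff_1 x)\<^sup>2" "- (3 * (coeff_sqrt3 x)\<^sup>2)"]
    by (simp add: field_norm_def)
  thus "abs_q2_sqrt3 x \<le> 1" by (simp add: abs_q2_sqrt3_def)
qed

lemma abs_q2_sqrt3_ultra: "abs_q2_sqrt3 (x + y) \<le> max (abs_q2_sqrt3 x) (abs_q2_sqrt3 y)"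
proof -
  have *: "abs_q2_sqrt3 (x + y) \<le> abs_q2_sqrt3 x" if le: "abs_q2_sqrt3 y \<le> abs_q2_sqrt3 x" for x y
  proof (cases "x = 0")
    case False
    have xy: "y = x * (y / x)" using False by simp
    have "abs_q2_sqrt3 x * abs_q2_sqrt3 (y / x) \<le> abs_q2_sqrt3 x * 1"
      using le xy by (metis abs_q2_sqrt3_mult mult.right_neutral)
    moreover have pos: "abs_q2_sqrt3 x > 0" using False by (simp add: order_less_le)
    ultimately have z: "abs_q2_sqrt3 (y / x) \<le> 1" by simp
    have "abs_q2 (1 + coeff_1 (y / x)) \<le> 1"
      using abs_q2_ultra[of 1 "coeff_1 (y / x)"] z by (simp add: abs_q2_sqrt3_le_1_iff)
    hence "abs_q2_sqrt3 (1 + y / x) \<le> 1"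
      using z by (simp add: abs_q2_sqrt3_le_1_iff one_q2_sqrt3_def plus_q2_sqrt3_def)
    hence "abs_q2_sqrt3 x * abs_q2_sqrt3 (1 + y / x) \<le> abs_q2_sqrt3 x * 1"
      using pos by (intro mult_left_mono) auto
    moreover have "x * (1 + y / x) = x + y" using False by (simp add: field_simps)
    ultimately show ?thesis by (metis abs_q2_sqrt3_mult mult.right_neutral)
  qed (use le in auto)
  show ?thesis using *[of x y] *[of y x]
    by (cases "abs_q2_sqrt3 y \<le> abs_q2_sqrt3 x") (auto simp: add.commute)
qed

instantiation q2_sqrt3 :: metric_space
begin

definition dist_q2_sqrt3 :: "q2_sqrt3 \<Rightarrow> q2_sqrt3 \<Rightarrow> real" where
  "dist x y = abs_q2_sqrt3 (x - y)"

definition uniformity_q2_sqrt3_def: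
  "(uniformity :: (q2_sqrt3 \<times> q2_sqrt3) filter) = (INF e\<in>{0 <..}. principal {(x, y). dist x y < e})"

definition open_q2_sqrt3_def:
  "open (U :: q2_sqrt3 set) \<longleftrightarrow> (\<forall>x\<in>U. \<forall>\<^sub>F (x', y) in uniformity. x' = x \<longrightarrow> y \<in> U)"

instance
proof
  fix x y z :: q2_sqrt3
  show "dist x y = 0 \<longleftrightarrow> x = y" by (simp add: dist_q2_sqrt3_def)
  have "abs_q2_sqrt3 (x - y) \<le> max (abs_q2_sqrt3 (x - z)) (abs_q2_sqrt3 (- (y - z)))"
    using abs_q2_sqrt3_ultra[of "x - z" "- (y - z)"] by simp
  thus "dist x y \<le> dist x z + dist y z"
    unfolding dist_q2_sqrt3_def abs_q2_sqrt3_minus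
    using abs_q2_sqrt3_nonneg[of "x - z"] abs_q2_sqrt3_nonneg[of "y - z"] by linarith
qed (rule uniformity_q2_sqrt3_def open_q2_sqrt3_def)+

end

definition Q_adjoin_sqrt3 :: "q2_sqrt3 set" where
  "Q_adjoin_sqrt3 = {of_rat a + of_rat b * sqrt3 | a b. True}"

definition Z2_adjoin_sqrt3 :: "q2_sqrt3 set" where
  "Z2_adjoin_sqrt3 = {Q2_Sqrt3 a b | a b. a \<in> Z2 \<and> b \<in> Z2}"


section \<open>Admissible functions and their power series\<close>

definition finite_domain :: "(nat \<Rightarrow> enat) \<Rightarrow> nat set" where
  "finite_domain \<psi> = {n. \<psi> n \<noteq> \<infinity>}"

definition admissible :: "(nat \<Rightarrow> enat) \<Rightarrow> bool" where
  "admissible \<psi> \<longleftrightarrow>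
     ((\<exists>N. finite_domain \<psi> = {i. i \<le> N}) \<or> finite_domain \<psi> = UNIV) \<and>
     strict_mono_on (finite_domain \<psi>) \<psi>"

definition G_series :: "(nat \<Rightarrow> enat) \<Rightarrow> rat fps" where
  "G_series \<psi> = Abs_fps (\<lambda>n. if n \<in> finite_domain \<psi> then 2 ^ the_enat (\<psi> n) else 0)"

definition rational_fps :: "rat fps \<Rightarrow> bool" where
  "rational_fps f \<longleftrightarrow>
     (\<exists>p q. coeff q 0 \<noteq> 0 \<and> f = fps_of_poly p / fps_of_poly q)"

definition fps_value :: "rat fps \<Rightarrow> q2_sqrt3 \<Rightarrow> q2_sqrt3" where
  "fps_value f x = (\<Sum>n. of_rat (fps_nth f n) * x ^ n)"

end

theory Submission
  imports Defs "HOL-Computational_Algebra.Field_as_Ring"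
begin

text \<open>
  Write \<open>w\<close> for \<open>1 / \<surd>3\<close>. Its absolute value is 1 and the coefficients \<open>2\<^bsup>\<psi>(n)\<^esup>\<close> tend to 0
  at least geometrically, so the series at \<open>w\<close> converges, and to an integral element. What has to
  be shown is that the series is rational exactly if its value \<open>s\<close> lies in \<open>Q(\<surd>3)\<close>.

  If \<open>G = P / Q\<close> with \<open>P\<close> and \<open>Q\<close> coprime, then \<open>s Q(w) = P(w)\<close>. A common zero \<open>w\<close> of \<open>P\<close> and \<open>Q\<close>
  would contradict their Bezout identity, so \<open>s = P(w) / Q(w)\<close> lies in the field generated by \<open>w\<close>
  (\<open>rational_fps_value\<close>).

  For the converse let \<open>\<psi>\<close> be finite everywhere, the other case being that of a polynomial. Put
  \<open>d\<^sub>k = \<psi>(k+1) - \<psi>(k) \<ge> 1\<close> and normalise the tails of the series to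
  \<open>y\<^sub>k = (\<Sum>n\<ge>k. 2\<^bsup>\<psi>(n)\<^esup> w\<^sup>n) / (2\<^bsup>\<psi>(k)\<^esup> w\<^sup>k)\<close>. Then \<open>y\<^sub>k\<^sub>+\<^sub>1 = \<surd>3 (y\<^sub>k - 1) / 2\<^bsup>d\<^sub>k\<^esup>\<close>, an analogue of the
  iteration in the \<open>3x+1\<close> problem, with the decisive difference that the multiplier
  satisfies \<open>\<surd>3 < 2\<close>. Three facts now give periodicity if \<open>y\<^sub>0\<close> lies in \<open>Q(\<surd>3)\<close>.

  \<^item> The \<open>y\<^sub>k\<close> are 2-adically integral, and the recursion introduces only powers of 2 into
    denominators; so all coordinates of the \<open>y\<^sub>k\<close> have one common denominator.
  \<^item> Both real conjugates of \<open>y\<^sub>k\<close> stay bounded, as \<open>\<surd>3 / 2 < 1\<close>. Hence the \<open>y\<^sub>k\<close> take only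
    finitely many values (\<open>finite_orbit\<close>).
  \<^item> Each \<open>y\<^sub>k\<close> is congruent to 1, hence a unit, so \<open>\<bar>y\<^sub>k - 1\<bar> = 2\<^bsup>-d\<^sub>k\<^esup>\<close>: the value \<open>y\<^sub>k\<close> determines \<open>d\<^sub>k\<close>
    and therefore everything that follows.

  Thus \<open>y\<^sub>j = y\<^sub>k\<close> for some \<open>j < k\<close> makes the gaps \<open>d\<close> eventually periodic
  (\<open>eventually_periodic_gaps\<close>). Then the coefficients satisfy \<open>g(n+p) = 2\<^sup>c g(n)\<close> for large \<open>n\<close>, so that
  \<open>(1 - 2\<^sup>c T\<^sup>p) G\<close> is a polynomial.
\<close>

section \<open>Rational numbers inside the 2-adic fields\<close>

text \<open>The rational numbers embed into a field of characteristic 0 in one way only. This identifies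
  \<open>of_rat\<close> with the embedding by constant sequences and with the one into the first coordinate.\<close>

lemma of_rat_unique:
  fixes \<phi> :: "rat \<Rightarrow> 'a :: field_char_0"
  assumes one: "\<phi> 1 = 1" and add: "\<And>x y. \<phi> (x + y) = \<phi> x + \<phi> y"
    and mult: "\<And>x y. \<phi> (x * y) = \<phi> x * \<phi> y"
  shows "of_rat r = \<phi> r"
proof -
  have zero: "\<phi> 0 = 0" using add[of 0 0] by simp
  have minus: "\<phi> (- x) = - \<phi> x" for x
    using add[of x "- x"] zero by (simp add: eq_neg_iff_add_eq_0 add.commute)
  have nat: "\<phi> (of_nat n) = of_nat n" for n
    by (induct n) (simp_all add: zero one add)
  have int: "\<phi> (of_int i) = of_int i" for i
    by (cases i rule: int_cases2) (simp_all add: nat minus)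
  obtain a b where r: "r = of_int a / of_int b" "b \<noteq> 0" by (rule rat_eq_quotient)
  have "\<phi> r * of_int b = of_int a"
    using mult[of r "of_int b"] r by (simp add: int)
  hence "\<phi> r = of_int a / of_int b" using r(2) by (simp add: nonzero_eq_divide_eq)
  thus ?thesis by (simp add: r(1) of_rat_divide)
qed

lemma of_rat_q2: "of_rat r = Q2 (\<lambda>_. r)"
proof (rule of_rat_unique)
  show "Q2 (\<lambda>_. 1) = 1" by (simp add: one_q2_def)
  show "Q2 (\<lambda>_. x + y) = Q2 (\<lambda>_. x) + Q2 (\<lambda>_. y)" for x y
    by (rule plus_q2.abs_eq[symmetric]) (simp_all add: q2rel_def)
  show "Q2 (\<lambda>_. x * y) = Q2 (\<lambda>_. x) * Q2 (\<lambda>_. y)" for x y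
    by (rule times_q2.abs_eq[symmetric]) (simp_all add: q2rel_def)
qed

lemma abs_q2_of_rat [simp]: "abs_q2 (of_rat r) = abs2 r"
  unfolding of_rat_q2 by (subst abs_q2.abs_eq) (simp_all add: q2rel_def limI)

lemma of_rat_q2_sqrt3: "of_rat r = Q2_Sqrt3 (of_rat r) 0"
  by (rule of_rat_unique)
    (simp_all add: one_q2_sqrt3_def plus_q2_sqrt3_def times_q2_sqrt3_def of_rat_add of_rat_mult)

lemma abs_q2_sqrt3_of_rat [simp]: "abs_q2_sqrt3 (of_rat r) = abs2 r"
  by (simp add: of_rat_q2_sqrt3 abs_q2_sqrt3_of_q2)

lemma of_rat_plus_sqrt3: "of_rat a + of_rat b * sqrt3 = Q2_Sqrt3 (of_rat a) (of_rat b)"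
  by (simp add: of_rat_q2_sqrt3 sqrt3_def plus_q2_sqrt3_def times_q2_sqrt3_def)

lemma abs_q2_sqrt3_power: "abs_q2_sqrt3 (x ^ n) = abs_q2_sqrt3 x ^ n"
proof (induct n)
  case 0
  show ?case using abs_q2_sqrt3_of_rat[of 1] by simp
qed (simp add: abs_q2_sqrt3_mult)

lemma abs_q2_sqrt3_inverse: "abs_q2_sqrt3 (1 / x) = 1 / abs_q2_sqrt3 x"
proof (cases "x = 0")
  case False
  hence "abs_q2_sqrt3 x * abs_q2_sqrt3 (1 / x) = 1"
    using abs_q2_sqrt3_power[of x 0] by (simp flip: abs_q2_sqrt3_mult)
  thus ?thesis using False by (simp add: field_simps)
next
  case True
  have "abs_q2_sqrt3 0 = 0" by simp
  thus ?thesis by (simp only: True div_by_0)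
qed

lemma abs_sqrt3 [simp]: "abs_q2_sqrt3 sqrt3 = 1"
proof -
  have "abs_q2_sqrt3 sqrt3 ^ 2 = abs_q2_sqrt3 (of_rat 3)"
    by (simp add: sqrt3_square flip: abs_q2_sqrt3_power)
  also have "\<dots> = 1" unfolding abs_q2_sqrt3_of_rat using abs2_odd[of 3] by simp
  finally show ?thesis by (simp add: power2_eq_1_iff) (use abs_q2_sqrt3_nonneg[of sqrt3] in linarith)
qed

lemma abs_q2_sqrt3_2 [simp]: "abs_q2_sqrt3 2 = 1 / 2"
  using abs_q2_sqrt3_of_rat[of 2] abs2_quotient[of 2 1] by (simp add: power_int_minus)

lemma abs_q2_sqrt3_minus_commute: "abs_q2_sqrt3 (x - y) = abs_q2_sqrt3 (y - x)"
  using abs_q2_sqrt3_minus[of "x - y"] by simp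

lemma Q_adjoin_sqrt3_eq: "Q_adjoin_sqrt3 = {Q2_Sqrt3 (of_rat a) (of_rat b) | a b. True}"
  by (simp add: Q_adjoin_sqrt3_def of_rat_plus_sqrt3)

lemma of_rat_in_Q_adjoin_sqrt3: "of_rat r \<in> Q_adjoin_sqrt3"
  unfolding Q_adjoin_sqrt3_def by (auto intro: exI[of _ r] exI[of _ 0])

lemma sqrt3_in_Q_adjoin_sqrt3: "sqrt3 \<in> Q_adjoin_sqrt3"
  unfolding Q_adjoin_sqrt3_def by (auto intro: exI[of _ 1] exI[of _ 0])

lemma Q_adjoin_sqrt3_add: "x \<in> Q_adjoin_sqrt3 \<Longrightarrow> y \<in> Q_adjoin_sqrt3 \<Longrightarrow> x + y \<in> Q_adjoin_sqrt3"
  unfolding Q_adjoin_sqrt3_eq by (auto simp: plus_q2_sqrt3_def simp flip: of_rat_add)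

lemma Q_adjoin_sqrt3_mult: "x \<in> Q_adjoin_sqrt3 \<Longrightarrow> y \<in> Q_adjoin_sqrt3 \<Longrightarrow> x * y \<in> Q_adjoin_sqrt3"
proof -
  have *: "of_rat a + 3 * of_rat b = (of_rat (a + 3 * b) :: q2)" for a b
    by (simp add: of_rat_add of_rat_mult)
  show "x \<in> Q_adjoin_sqrt3 \<Longrightarrow> y \<in> Q_adjoin_sqrt3 \<Longrightarrow> x * y \<in> Q_adjoin_sqrt3"
    unfolding Q_adjoin_sqrt3_eq
    by (auto simp: times_q2_sqrt3_def * simp flip: of_rat_add of_rat_mult)
qed

lemma Q_adjoin_sqrt3_inverse: 
  assumes "x \<in> Q_adjoin_sqrt3"
  shows "inverse x \<in> Q_adjoin_sqrt3"
proof -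
  obtain a b where x: "x = Q2_Sqrt3 (of_rat a) (of_rat b)" 
    using assms unfolding Q_adjoin_sqrt3_eq by blast
  have "field_norm x = of_rat (a\<^sup>2 - 3 * b\<^sup>2)"
    by (simp add: x field_norm_def of_rat_diff of_rat_mult of_rat_power)
  hence "inverse x = Q2_Sqrt3 (of_rat (a / (a\<^sup>2 - 3 * b\<^sup>2))) (of_rat (- b / (a\<^sup>2 - 3 * b\<^sup>2)))"
    by (simp add: inverse_q2_sqrt3_def x of_rat_divide of_rat_minus)
  thus ?thesis unfolding Q_adjoin_sqrt3_eq by blast
qed

section \<open>Convergence of series\<close>

text \<open>The part of the completeness of the 2-adic field that the theorem needs: a Cauchy sequence of
  rationals converges, because it is itself a representative of its limit. The modulus \<open>e\<close> passes
  to the limit, so that later the size of a tail can be read off from its first term.\<close>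

lemma q2_limit_of_rationals:
  assumes X: "\<And>N m. N \<le> m \<Longrightarrow> abs2 (X m - X N) \<le> e N" and e: "e \<longlonglongrightarrow> 0"
  obtains x where "\<And>N. abs_q2 (x - of_rat (X N)) \<le> e N"
proof -
  have cauchy: "cauchy2 X"
    unfolding cauchy2_def
  proof (intro allI impI)
    fix r :: real assume "r > 0"
    hence "eventually (\<lambda>N. e N < r) sequentially" using e by (simp add: order_tendstoD)
    then obtain N where N: "e N < r" by (auto simp: eventually_sequentially)
    have "abs2 (X m - X n) < r" if "m \<ge> N" "n \<ge> N" for m n
      using abs2_ultra[of "X m - X N" "X N - X n"] X[OF that(1)] X[OF that(2)] N
      by (simp add: abs2_minus_commute[of "X N"])
    thus "\<exists>N. \<forall>m\<ge>N. \<forall>n\<ge>N. abs2 (X m - X n) < r" by blast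
  qed
  have "abs_q2 (Q2 X - of_rat (X N)) \<le> e N" for N
  proof -
    have "- of_rat (X N) = Q2 (\<lambda>_. - X N)" by (simp flip: of_rat_q2 add: of_rat_minus)
    hence "Q2 X - of_rat (X N) = Q2 (\<lambda>m. X m + - X N)"
      using plus_q2.abs_eq[of X "\<lambda>_. - X N"] cauchy
      by (simp add: q2rel_def minus_q2_def)
    hence "abs_q2 (Q2 X - of_rat (X N)) = lim (\<lambda>m. abs2 (X m - X N))"
      using cauchy by (simp add: abs_q2.abs_eq q2rel_def)
    also have "\<dots> \<le> e N"
      by (rule LIMSEQ_le_const2[OF lim_abs2]) (use X cauchy in auto)
    finally show ?thesis .
  qed
  thus ?thesis by (rule that)
qed

lemma abs2_sum_le:
  fixes e :: "nat \<Rightarrow> real"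
  assumes "\<And>n. abs2 (c n) \<le> e n" "antimono e" "N \<le> m"
  shows "abs2 ((\<Sum>n<m. c n) - (\<Sum>n<N. c n)) \<le> e N"
  using assms(3)
proof (induct m rule: dec_induct)
  case base
  show ?case using order_trans[OF abs2_nonneg assms(1)[of N]] by simp
next
  case (step m)
  have "abs2 (c m) \<le> e N" using assms(1)[of m] antimonoD[OF assms(2) step(1)] by simp
  thus ?case
    using step(3) abs2_ultra[of "c m" "(\<Sum>n<m. c n) - (\<Sum>n<N. c n)"]
    by (simp add: algebra_simps)
qed

lemma q2_sqrt3_series_limit:
  fixes a b :: "nat \<Rightarrow> rat"
  assumes a: "\<And>n. abs2 (a n) \<le> e n" and b: "\<And>n. abs2 (b n) \<le> e n"
    and e: "antimono e" "e \<longlonglongrightarrow> 0"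
  obtains s where
    "\<And>N. abs_q2_sqrt3 (s - (\<Sum>n<N. of_rat (a n) + of_rat (b n) * sqrt3)) \<le> e N"
proof -
  obtain x where x: "\<And>N. abs_q2 (x - of_rat (\<Sum>n<N. a n)) \<le> e N"
    using q2_limit_of_rationals[OF abs2_sum_le[OF a e(1)] e(2)] by blast
  obtain y where y: "\<And>N. abs_q2 (y - of_rat (\<Sum>n<N. b n)) \<le> e N"
    using q2_limit_of_rationals[OF abs2_sum_le[OF b e(1)] e(2)] by blast
  have "abs_q2_sqrt3 (Q2_Sqrt3 x y - (\<Sum>n<N. of_rat (a n) + of_rat (b n) * sqrt3)) \<le> e N" for N
  proof -
    let ?x = "x - of_rat (\<Sum>n<N. a n)" and ?y = "y - of_rat (\<Sum>n<N. b n)"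
    have "(\<Sum>n<N. of_rat (a n) + of_rat (b n) * sqrt3)
        = of_rat (\<Sum>n<N. a n) + of_rat (\<Sum>n<N. b n) * sqrt3"
      by (simp add: sum.distrib of_rat_sum sum_distrib_right)
    hence "Q2_Sqrt3 x y - (\<Sum>n<N. of_rat (a n) + of_rat (b n) * sqrt3)
        = Q2_Sqrt3 ?x 0 + Q2_Sqrt3 ?y 0 * sqrt3"
      by (simp only: of_rat_plus_sqrt3) 
        (simp add: sqrt3_def plus_q2_sqrt3_def minus_q2_sqrt3_def times_q2_sqrt3_def)
    thus ?thesis
      using abs_q2_sqrt3_ultra[of "Q2_Sqrt3 ?x 0" "Q2_Sqrt3 ?y 0 * sqrt3"] x[of N] y[of N]
      by (simp add: abs_q2_sqrt3_mult abs_q2_sqrt3_of_q2)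
  qed
  thus ?thesis by (rule that)
qed

text \<open>Powers of \<open>1 / \<surd>3 = \<surd>3 / 3\<close> have rational coordinates with odd denominators. Hence the partial
  sums of the series have rational coordinates, and their limit can be taken coordinatewise.\<close>

lemma inverse_sqrt3_power:
  "\<exists>u v. (1 / sqrt3) ^ n = of_rat u + of_rat v * sqrt3 \<and> abs2 u \<le> 1 \<and> abs2 v \<le> 1"
proof (induct n)
  case 0
  show ?case by (intro exI[of _ 1] exI[of _ 0]) simp
next
  case (Suc n)
  then obtain u v where uv: "(1 / sqrt3) ^ n = of_rat u + of_rat v * sqrt3"
    "abs2 u \<le> 1" "abs2 v \<le> 1" by blast
  have nz: "sqrt3 \<noteq> 0" using abs_sqrt3 by (metis abs_q2_sqrt3_eq_0 zero_neq_one)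
  have s: "sqrt3 * sqrt3 = 3" using sqrt3_square by (simp add: power2_eq_square)
  have inv: "1 / sqrt3 = sqrt3 / 3" using nz s by (simp add: field_simps)
  have "(1 / sqrt3) ^ Suc n = sqrt3 / 3 * (of_rat u + of_rat v * sqrt3)"
    by (simp only: power_Suc flip: uv(1) inv)
  also have "\<dots> = of_rat u * sqrt3 / 3 + of_rat v * (sqrt3 * sqrt3) / 3"
    by (simp add: algebra_simps)
  finally have "(1 / sqrt3) ^ Suc n = of_rat v + of_rat (u / 3) * sqrt3"
    by (simp add: s of_rat_divide)
  moreover have "abs2 3 = 1" using abs2_odd[of 3] by simp
  hence "abs2 (u / 3) \<le> 1" using uv(2) abs2_mult[of "u / 3" 3] by simp
  ultimately show ?case using uv(3) by blast
qed

lemma inverse_sqrt3_series_limit: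
  assumes c: "\<And>n. abs2 (c n) \<le> e n" and e: "antimono e" "e \<longlonglongrightarrow> 0"
  obtains s where
    "\<And>N. abs_q2_sqrt3 (s - (\<Sum>n<N. of_rat (c n) * (1 / sqrt3) ^ n)) \<le> e N"
    "(\<lambda>n. of_rat (c n) * (1 / sqrt3) ^ n) sums s"
proof -
  obtain u v where uv: "\<And>n. (1 / sqrt3) ^ n = of_rat (u n) + of_rat (v n) * sqrt3"
    "\<And>n. abs2 (u n) \<le> 1" "\<And>n. abs2 (v n) \<le> 1"
    using inverse_sqrt3_power by metis
  have bound: "abs2 (c n * w) \<le> e n" if "abs2 w \<le> 1" for w n
  proof -
    have "abs2 (c n) * abs2 w \<le> abs2 (c n) * 1" using that by (intro mult_left_mono) auto
    thus ?thesis using c[of n] by (simp add: abs2_mult)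
  qed
  have term_eq: "of_rat (c n) * (1 / sqrt3) ^ n = of_rat (c n * u n) + of_rat (c n * v n) * sqrt3" for n
    by (simp only: uv(1) of_rat_mult distrib_left mult.assoc)
  have cu: "abs2 (c n * u n) \<le> e n" and cv: "abs2 (c n * v n) \<le> e n" for n
    by (rule bound uv)+
  obtain s where s: "\<And>N. abs_q2_sqrt3
      (s - (\<Sum>n<N. of_rat (c n * u n) + of_rat (c n * v n) * sqrt3)) \<le> e N"
    by (rule q2_sqrt3_series_limit[OF cu cv e]) blast
  note s = s[folded term_eq]
  have "(\<lambda>N. dist (\<Sum>n<N. of_rat (c n) * (1 / sqrt3) ^ n) s) \<longlonglongrightarrow> 0"
    by (rule tendsto_sandwich[OF _ _ tendsto_const e(2)])
      (use s in \<open>auto simp: dist_q2_sqrt3_def abs_q2_sqrt3_minus_commute[of _ s]\<close>)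
  hence "(\<lambda>n. of_rat (c n) * (1 / sqrt3) ^ n) sums s"
    unfolding sums_def by (subst tendsto_dist_iff)
  show ?thesis by (rule that[OF s]) fact
qed

text \<open>Continuity of addition makes the general rules on \<open>sums\<close> applicable to 2-adic series.\<close>

instance q2_sqrt3 :: topological_comm_monoid_add
proof
  fix a b :: q2_sqrt3
  show "LIM x (nhds a \<times>\<^sub>F nhds b). fst x + snd x :> nhds (a + b)"
  proof (rule tendstoI)
    fix e :: real assume e: "e > 0"
    have "eventually (\<lambda>x. dist x c < e) (nhds c)" for c :: q2_sqrt3
      using e by (auto simp: eventually_nhds_metric)
    from eventually_prodI[OF this[of a] this[of b]]
    show "eventually (\<lambda>x. dist (fst x + snd x) (a + b) < e) (nhds a \<times>\<^sub>F nhds b)"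
    proof eventually_elim
      case (elim x)
      have "dist (fst x + snd x) (a + b) \<le> max (dist (fst x) a) (dist (snd x) b)"
        using abs_q2_sqrt3_ultra[of "fst x - a" "snd x - b"]
        by (simp add: dist_q2_sqrt3_def add_diff_add)
      thus ?case using elim by (auto simp: max_def split: if_splits)
    qed
  qed
qed

lemma q2_sqrt3_sums_mult:
  fixes c :: q2_sqrt3
  assumes "t sums s"
  shows "(\<lambda>n. c * t n) sums (c * s)"
proof -
  have "(\<lambda>N. abs_q2_sqrt3 c * dist (\<Sum>n<N. t n) s) \<longlonglongrightarrow> 0"
    using assms unfolding sums_def by (intro tendsto_mult_right_zero) (simp flip: tendsto_dist_iff)
  moreover have "abs_q2_sqrt3 c * dist (\<Sum>n<N. t n) s = dist (\<Sum>n<N. c * t n) (c * s)" for N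
    by (simp add: dist_q2_sqrt3_def right_diff_distrib sum_distrib_left flip: abs_q2_sqrt3_mult)
  ultimately show ?thesis unfolding sums_def by (subst tendsto_dist_iff) simp
qed

section \<open>Values of rational power series\<close>

lemma map_poly_of_rat_add:
  "map_poly (of_rat :: rat \<Rightarrow> 'a :: field_char_0) (p + q) = map_poly of_rat p + map_poly of_rat q"
  by (rule poly_eqI) (simp add: coeff_map_poly of_rat_add)

lemma map_poly_of_rat_mult:
  "map_poly (of_rat :: rat \<Rightarrow> 'a :: field_char_0) (p * q) = map_poly of_rat p * map_poly of_rat q"
  by (rule poly_eqI) (simp add: coeff_map_poly coeff_mult of_rat_sum of_rat_mult)

lemma coprime_no_common_root:
  fixes x :: "'a :: field_char_0"
  assumes "coprime p q" "poly (map_poly of_rat p) x = 0"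
  shows "poly (map_poly of_rat q) x \<noteq> 0"
proof
  assume 0: "poly (map_poly of_rat q) x = 0"
  have "fst (bezout_coefficients p q) * p + snd (bezout_coefficients p q) * q = 1"
    using assms(1) by (simp add: bezout_coefficients_fst_snd)
  then obtain u v where uv: "u * p + v * q = 1" by blast
  have "poly (map_poly of_rat (u * p + v * q)) x = 0"
    using assms(2) 0 by (simp add: map_poly_of_rat_add map_poly_of_rat_mult)
  thus False by (simp add: uv map_poly_1')
qed

lemma series_times_poly_sums:
  fixes x :: q2_sqrt3
  assumes "(\<lambda>n. of_rat (fps_nth F n) * x ^ n) sums s"
  shows "(\<lambda>n. of_rat (fps_nth (F * fps_of_poly q) n) * x ^ n)
    sums (s * poly (map_poly of_rat q) x)"
proof (induct q)
  case 0
  show ?case by simp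
next
  case (pCons a q)
  let ?H = "F * fps_of_poly q"
  have 1: "(\<lambda>n. of_rat a * (of_rat (fps_nth F n) * x ^ n)) sums (of_rat a * s)"
    by (rule q2_sqrt3_sums_mult[OF assms])
  have nth_Suc: "fps_nth (fps_X * H) (Suc n) = fps_nth H n" for n and H :: "rat fps"
    by simp
  have 2: "(\<lambda>n. of_rat (fps_nth (fps_X * ?H) n) * x ^ n) sums
      (x * (s * poly (map_poly of_rat q) x) + of_rat (fps_nth (fps_X * ?H) 0) * x ^ 0)"
  proof (rule sums_Suc)
    show "(\<lambda>n. of_rat (fps_nth (fps_X * ?H) (Suc n)) * x ^ Suc n) sums
        (x * (s * poly (map_poly of_rat q) x))"
      unfolding nth_Suc
      using q2_sqrt3_sums_mult[OF pCons(2), of x] by (simp add: mult.left_commute)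
  qed
  have "F * fps_of_poly (pCons a q) = fps_const a * F + fps_X * ?H"
    by (simp add: fps_of_poly_pCons algebra_simps)
  hence eq: "of_rat (fps_nth (F * fps_of_poly (pCons a q)) n) * x ^ n
      = of_rat a * (of_rat (fps_nth F n) * x ^ n) + of_rat (fps_nth (fps_X * ?H) n) * x ^ n" for n
    by (simp only: fps_add_nth fps_mult_left_const_nth of_rat_add of_rat_mult distrib_right mult.assoc)
  show ?case
    using sums_add[OF 1 2] unfolding eq by (simp add: map_poly_pCons algebra_simps)
qed

lemma poly_sums:
  fixes x :: q2_sqrt3
  shows "(\<lambda>n. of_rat (coeff p n) * x ^ n) sums poly (map_poly of_rat p) x"
proof -
  have "(\<lambda>n. of_rat (fps_nth 1 n) * x ^ n) sums (\<Sum>n\<in>{0}. of_rat (fps_nth 1 n) * x ^ n)"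
    by (rule sums_finite) auto
  from series_times_poly_sums[OF this, of p] show ?thesis by simp
qed

lemma poly_of_rat_in_Q_adjoin_sqrt3:
  assumes "x \<in> Q_adjoin_sqrt3"
  shows "poly (map_poly of_rat p) x \<in> Q_adjoin_sqrt3"
proof (induct p)
  case 0
  show ?case using of_rat_in_Q_adjoin_sqrt3[of 0] by simp
next
  case (pCons a p)
  thus ?case
    using assms by (simp add: map_poly_pCons Q_adjoin_sqrt3_add Q_adjoin_sqrt3_mult of_rat_in_Q_adjoin_sqrt3)
qed

text \<open>Passing to lowest terms is essential: the denominator may vanish at \<open>x\<close> in a fraction
  that is not reduced.\<close>

lemma rational_fps_value:
  assumes "rational_fps F" and s: "(\<lambda>n. of_rat (fps_nth F n) * x ^ n) sums s"
    and x: "x \<in> Q_adjoin_sqrt3"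
  shows "s \<in> Q_adjoin_sqrt3"
proof -
  obtain p q where q: "coeff q 0 \<noteq> 0" and F: "F = fps_of_poly p / fps_of_poly q"
    using assms(1) unfolding rational_fps_def by blast
  have q0: "q \<noteq> 0" using q by auto
  have "fps_nth (fps_of_poly q) 0 \<noteq> 0" using q by simp
  hence Fq: "F * fps_of_poly q = fps_of_poly p"
    by (simp add: F fps_divide_unit mult.assoc inverse_mult_eq_1)
  obtain p' q' where pq: "p = p' * gcd p q" "q = q' * gcd p q" "coprime p' q'"
    using gcd_coprime_exists[of p q] q0 by auto
  have g: "fps_of_poly (gcd p q) \<noteq> 0" using q0 fps_of_poly_eq_iff[of "gcd p q" 0] by simp
  have "(F * fps_of_poly q') * fps_of_poly (gcd p q) = fps_of_poly p' * fps_of_poly (gcd p q)"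
    using Fq pq(1,2) by (metis fps_of_poly_mult mult.assoc)
  hence "F * fps_of_poly q' = fps_of_poly p'" using g by simp
  with series_times_poly_sums[OF s, of q'] poly_sums[of p' x]
  have eq: "s * poly (map_poly of_rat q') x = poly (map_poly of_rat p') x"
    by (auto intro: sums_unique2)
  have nz: "poly (map_poly of_rat q') x \<noteq> 0"
  proof
    assume 0: "poly (map_poly of_rat q') x = 0"
    hence "poly (map_poly of_rat p') x = 0" using eq by simp
    thus False using coprime_no_common_root[OF pq(3)] 0 by blast
  qed
  have "s = poly (map_poly of_rat p') x * inverse (poly (map_poly of_rat q') x)"
    using eq nz by (simp add: field_simps)
  thus ?thesis
    using x by (simp add: Q_adjoin_sqrt3_mult Q_adjoin_sqrt3_inverse poly_of_rat_in_Q_adjoin_sqrt3)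
qed

lemma rational_fps_if_recurrence:
  assumes "p > 0" and rec: "\<And>n. n \<ge> j \<Longrightarrow> fps_nth F (n + p) = c * fps_nth F n"
  shows "rational_fps F"
proof -
  define Q where "Q = 1 - monom c p"
  define P where "P = truncate_fps (j + p) (F * fps_of_poly Q)"
  have "fps_nth (F * fps_of_poly Q) n = 0" if "n \<ge> j + p" for n
  proof -
    have "F * fps_of_poly Q = F - fps_const c * (fps_X ^ p * F)"
      by (simp add: Q_def fps_of_poly_diff fps_of_poly_monom algebra_simps)
    hence "fps_nth (F * fps_of_poly Q) n = fps_nth F n - c * fps_nth F (n - p)"
      using that by (simp add: fps_X_power_mult_nth)
    thus ?thesis using rec[of "n - p"] that by simp
  qed
  hence P: "F * fps_of_poly Q = fps_of_poly P"
    unfolding P_def by (intro fps_ext) (simp add: coeff_truncate_fps)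
  have Q: "coeff Q 0 \<noteq> 0" using assms(1) by (simp add: Q_def)
  hence "fps_of_poly Q \<noteq> 0" using fps_of_poly_eq_iff[of Q 0] by auto
  hence "F = fps_of_poly P / fps_of_poly Q" by (simp flip: P)
  thus ?thesis unfolding rational_fps_def using Q by blast
qed

section \<open>Periodicity of the normalised tails\<close>

text \<open>Only powers of 2 are at stake in the denominator of \<open>r\<close>, and integrality at 2 rules them out.\<close>

lemma Ints_if_power_2_multiple:
  assumes "abs2 r \<le> 1" "2 ^ d * r \<in> \<int>"
  shows "r \<in> \<int>"
proof -
  obtain a b where r: "r = of_int a / of_int b" and b: "odd b"
    using abs2_le_1_denom[OF assms(1)] .
  have b0: "b \<noteq> 0" using b by auto
  obtain m where "2 ^ d * r = of_int m" using assms(2) by (auto elim: Ints_cases)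
  hence "of_int (2 ^ d * a) = (of_int (m * b) :: rat)" using b0 by (simp add: r field_simps)
  hence "2 ^ d * a = m * b" by (simp only: of_int_eq_iff)
  hence "b dvd 2 ^ d * a" by simp
  moreover have "coprime b (2 ^ d)" using b by (simp add: coprime_power_right_iff)
  ultimately have "b dvd a" by (simp add: coprime_dvd_mult_right_iff)
  then obtain k where "a = b * k" by blast
  thus ?thesis using b0 by (simp add: r)
qed

lemma finite_rat_bounded_denominator:
  fixes D M :: rat
  assumes "D > 0"
  shows "finite {r. D * r \<in> \<int> \<and> \<bar>r\<bar> \<le> M}"
proof (rule finite_surj)
  show "finite {- \<lceil>D * M\<rceil>..\<lceil>D * M\<rceil>}" by simp
  show "{r. D * r \<in> \<int> \<and> \<bar>r\<bar> \<le> M} \<subseteq> (\<lambda>i. of_int i / D) ` {- \<lceil>D * M\<rceil>..\<lceil>D * M\<rceil>}"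
  proof safe
    fix r assume r: "D * r \<in> \<int>" "\<bar>r\<bar> \<le> M"
    obtain i where i: "D * r = of_int i" using r(1) by (auto elim: Ints_cases)
    have "of_int \<bar>i\<bar> = D * \<bar>r\<bar>" using assms by (simp flip: i add: abs_mult)
    also have "\<dots> \<le> D * M" using r(2) assms by simp
    also have "\<dots> \<le> of_int \<lceil>D * M\<rceil>" by simp
    finally have "\<bar>i\<bar> \<le> \<lceil>D * M\<rceil>" by linarith
    moreover have "r = of_int i / D" using i assms by (simp add: field_simps)
    ultimately show "r \<in> (\<lambda>i. of_int i / D) ` {- \<lceil>D * M\<rceil>..\<lceil>D * M\<rceil>}"
      by (intro image_eqI[of _ _ i]) (simp_all add: abs_le_iff)
  qed
qed

lemma common_denominator:
  obtains D :: rat where "D > 0" "D \<in> \<int>" "D * a \<in> \<int>" "D * b \<in> \<int>"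
proof -
  obtain p q where a: "quotient_of a = (p, q)" by fastforce
  obtain p' q' where b: "quotient_of b = (p', q')" by fastforce
  have q: "q > 0" "q' > 0" using quotient_of_denom_pos a b by blast+
  have "of_int (q * q') * a = of_int (q' * p)" "of_int (q * q') * b = of_int (q * p')"
    using quotient_of_div[OF a] quotient_of_div[OF b] q by simp_all
  thus ?thesis using that[of "of_int (q * q')"] q by (metis Ints_of_int mult_pos_pos of_int_0_less_iff)
qed

text \<open>In coordinates the recursion sends \<open>a + b \<surd>3\<close> to \<open>3 b / 2\<^sup>d + ((a - 1) / 2\<^sup>d) \<surd>3\<close>. The hypothesis
  that all \<open>y k\<close> are integral at 2 keeps the denominator of the starting point valid for the whole
  orbit. The real size is measured by the rational norm \<open>4 \<bar>a\<bar> + 7 \<bar>b\<bar>\<close>: the ratio 7/4 of the weights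
  approximates \<open>\<surd>3\<close>, closely enough for the linear part to contract by the factor 7/8. As the
  translation adds at most 7/2, the norm never exceeds the larger of 28 and its
  initial value.\<close>

lemma finite_orbit:
  fixes y :: "nat \<Rightarrow> q2_sqrt3" and d :: "nat \<Rightarrow> nat"
  assumes y0: "y 0 \<in> Q_adjoin_sqrt3" and d: "\<And>k. d k \<ge> 1"
    and y_le: "\<And>k. abs_q2_sqrt3 (y k) \<le> 1"
    and y_Suc: "\<And>k. y (Suc k) = sqrt3 * (y k - 1) / 2 ^ d k"
  shows "finite (range y)"
proof -
  obtain a0 b0 where y0_eq: "y 0 = Q2_Sqrt3 (of_rat a0) (of_rat b0)"
    using y0 unfolding Q_adjoin_sqrt3_eq by blast
  obtain D where D: "D > 0" "D \<in> \<int>" "D * a0 \<in> \<int>" "D * b0 \<in> \<int>"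
    by (rule common_denominator)
  define M where "M = max (4 * \<bar>a0\<bar> + 7 * \<bar>b0\<bar>) 28"
  let ?A = "{r. D * r \<in> \<int> \<and> \<bar>r\<bar> \<le> M}"
  have D_le: "abs2 D \<le> 1" using D(2) abs2_of_int_le_1 by (auto elim: Ints_cases)
  have step: "\<exists>a b. y k = Q2_Sqrt3 (of_rat a) (of_rat b) \<and> D * a \<in> \<int> \<and> D * b \<in> \<int> \<and>
      4 * \<bar>a\<bar> + 7 * \<bar>b\<bar> \<le> M" for k
  proof (induct k)
    case 0
    show ?case using y0_eq D by (auto simp: M_def)
  next
    case (Suc k)
    then obtain a b where ab: "y k = Q2_Sqrt3 (of_rat a) (of_rat b)" "D * a \<in> \<int>" "D * b \<in> \<int>"
      "4 * \<bar>a\<bar> + 7 * \<bar>b\<bar> \<le> M" by blast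
    define a' b' where "a' = 3 * b / 2 ^ d k" and "b' = (a - 1) / 2 ^ d k"
    have s: "sqrt3 * sqrt3 = 3" using sqrt3_square by (simp add: power2_eq_square)
    have "sqrt3 * (y k - 1) = of_rat b * (sqrt3 * sqrt3) + of_rat (a - 1) * sqrt3"
      by (simp add: ab(1) flip: of_rat_plus_sqrt3) (simp add: algebra_simps of_rat_diff)
    hence "y (Suc k) = of_rat a' + of_rat b' * sqrt3"
      by (simp add: y_Suc s a'_def b'_def of_rat_divide of_rat_mult of_rat_power add_divide_distrib)
    hence y': "y (Suc k) = Q2_Sqrt3 (of_rat a') (of_rat b')" by (simp only: of_rat_plus_sqrt3)
    have le: "abs2 a' \<le> 1" "abs2 b' \<le> 1"
      using y_le[of "Suc k"] by (simp_all add: y' abs_q2_sqrt3_le_1_iff)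
    have Da: "D * a' \<in> \<int>"
    proof (rule Ints_if_power_2_multiple)
      show "abs2 (D * a') \<le> 1" using D_le le by (simp add: abs2_mult mult_le_one)
      have "2 ^ d k * (D * a') = 3 * (D * b)" by (simp add: a'_def)
      also have "\<dots> \<in> \<int>" by (rule Ints_mult[OF _ ab(3)]) simp
      finally show "2 ^ d k * (D * a') \<in> \<int>" .
    qed
    have Db: "D * b' \<in> \<int>"
    proof (rule Ints_if_power_2_multiple)
      show "abs2 (D * b') \<le> 1" using D_le le by (simp add: abs2_mult mult_le_one)
      have "2 ^ d k * (D * b') = D * a - D" by (simp add: b'_def algebra_simps)
      also have "\<dots> \<in> \<int>" using ab(2) D(2) by (intro Ints_diff)
      finally show "2 ^ d k * (D * b') \<in> \<int>" .
    qed
    have half: "2 * \<bar>r / 2 ^ d k\<bar> \<le> \<bar>r\<bar>" for r :: rat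
    proof -
      have "(2::rat) ^ 1 \<le> 2 ^ d k" using d[of k] by (intro power_increasing) auto
      hence "\<bar>r\<bar> * 2 \<le> \<bar>r\<bar> * 2 ^ d k" by (intro mult_left_mono) auto
      hence "\<bar>r\<bar> * 2 / 2 ^ d k \<le> \<bar>r\<bar>" by (simp add: pos_divide_le_eq)
      moreover have "2 * \<bar>r / 2 ^ d k\<bar> = \<bar>r\<bar> * 2 / 2 ^ d k" by (simp add: mult.commute)
      ultimately show ?thesis by (simp only:)
    qed
    have "2 * \<bar>a'\<bar> \<le> 3 * \<bar>b\<bar>" using half[of "3 * b"] by (simp add: a'_def abs_mult)
    moreover have "2 * \<bar>b'\<bar> \<le> \<bar>a\<bar> + 1"
      using order_trans[OF half[of "a - 1"] abs_triangle_ineq4[of a 1]] by (simp add: b'_def)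
    moreover have "M \<ge> 28" by (simp add: M_def)
    \<comment> \<open>\<open>4 A' + 7 B' \<le> 6 B + 7/2 (A + 1) \<le> 7/8 (4 A + 7 B) + 7/2 \<le> 7/8 M + M / 8\<close>\<close>
    moreover have "4 * A' + 7 * B' \<le> M"
      if "2 * A' \<le> 3 * B" "2 * B' \<le> A + 1" "M \<ge> 28" "4 * A + 7 * B \<le> M" "B \<ge> 0"
      for A B A' B' :: rat
      using that by linarith
    ultimately have "4 * \<bar>a'\<bar> + 7 * \<bar>b'\<bar> \<le> M" using ab(4) abs_ge_zero[of b] by blast
    thus ?case using y' Da Db by blast
  qed
  have "range y \<subseteq> (\<lambda>(a, b). Q2_Sqrt3 (of_rat a) (of_rat b)) ` (?A \<times> ?A)"
  proof
    fix z assume "z \<in> range y"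
    then obtain a b where ab: "z = Q2_Sqrt3 (of_rat a) (of_rat b)" "D * a \<in> \<int>" "D * b \<in> \<int>"
      "4 * \<bar>a\<bar> + 7 * \<bar>b\<bar> \<le> M" using step by blast
    have "(a, b) \<in> ?A \<times> ?A" using ab(2-4) abs_ge_zero[of a] abs_ge_zero[of b] by auto
    thus "z \<in> (\<lambda>(a, b). Q2_Sqrt3 (of_rat a) (of_rat b)) ` (?A \<times> ?A)" using ab(1) by force
  qed
  thus ?thesis
    using finite_rat_bounded_denominator[OF D(1)] by (meson finite_SigmaI finite_imageI finite_subset)
qed

text \<open>The quotients \<open>y k\<close> of the tails by their leading terms form an orbit as in \<open>finite_orbit\<close>.
  As a repeated value repeats its successor together with the gap, the orbit is
  eventually periodic along with the gaps.\<close>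

lemma eventually_periodic_gaps:
  fixes f :: "nat \<Rightarrow> nat"
  assumes f: "strict_mono f" and s: "s \<in> Q_adjoin_sqrt3"
    and tail: "\<And>N. abs_q2_sqrt3 (s - (\<Sum>n<N. 2 ^ f n * (1 / sqrt3) ^ n)) \<le> (1 / 2) ^ f N"
  obtains j p c where "p > 0" "\<And>n. n \<ge> j \<Longrightarrow> f (n + p) = f n + c"
proof -
  define S where "S N = (\<Sum>n<N. 2 ^ f n * (1 / sqrt3) ^ n)" for N
  define t where "t k = 2 ^ f k * (1 / sqrt3) ^ k" for k
  define y where "y k = (s - S k) / t k" for k
  define d where "d k = f (Suc k) - f k" for k
  have f_Suc: "f (Suc k) = f k + d k" and d_ge: "d k \<ge> 1" for k
    using strict_monoD[OF f, of k "Suc k"] by (simp_all add: d_def)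
  have nz: "sqrt3 \<noteq> 0" using abs_sqrt3 by (metis abs_q2_sqrt3_eq_0 zero_neq_one)
  have t_nz: "t k \<noteq> 0" for k using nz by (simp add: t_def)
  have abs_t: "abs_q2_sqrt3 (t k) = (1 / 2) ^ f k" for k
    by (simp add: t_def abs_q2_sqrt3_mult abs_q2_sqrt3_power abs_q2_sqrt3_inverse del: power_one_over)
  have t_Suc: "t (Suc k) = t k * (2 ^ d k / sqrt3)" for k
    by (simp add: t_def f_Suc power_add)
  have y_Suc: "y (Suc k) = sqrt3 * (y k - 1) / 2 ^ d k" for k
  proof -
    have "s - S k = t k * y k" using t_nz[of k] by (simp add: y_def)
    moreover have "S (Suc k) = S k + t k" by (simp add: S_def t_def)
    ultimately have "s - S (Suc k) = t k * (y k - 1)" by (simp add: algebra_simps)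
    thus ?thesis using t_nz[of k] nz unfolding y_def[of "Suc k"] t_Suc by simp
  qed
  have y_le: "abs_q2_sqrt3 (y k) \<le> 1" for k
  proof -
    have "y k * t k = s - S k" using t_nz by (simp add: y_def)
    hence "abs_q2_sqrt3 (y k) * (1 / 2) ^ f k \<le> 1 * (1 / 2) ^ f k"
      using tail[of k] by (metis S_def abs_q2_sqrt3_mult abs_t mult_1)
    thus ?thesis by (rule mult_right_le_imp_le) simp
  qed
  have y_minus_1: "abs_q2_sqrt3 (y k - 1) = (1 / 2) ^ d k * abs_q2_sqrt3 (y (Suc k))" for k
  proof -
    have "y k - 1 = 2 ^ d k * (1 / sqrt3) * y (Suc k)" using nz by (simp add: y_Suc)
    thus ?thesis
      by (simp only: abs_q2_sqrt3_mult abs_q2_sqrt3_power abs_q2_sqrt3_inverse) simp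
  qed
  have y_unit: "abs_q2_sqrt3 (y k) = 1" for k
  proof -
    have "(1 / 2) ^ d k \<le> (1 / 2 :: real) ^ 1" using d_ge by (intro power_decreasing) auto
    hence "(1 / 2) ^ d k * abs_q2_sqrt3 (y (Suc k)) \<le> 1 / 2 * (1::real)"
      using y_le[of "Suc k"] by (intro mult_mono) auto
    hence "abs_q2_sqrt3 (1 - y k) \<le> 1 / 2" 
      using y_minus_1[of k] by (simp add: abs_q2_sqrt3_minus_commute[of 1])
    moreover have "abs_q2_sqrt3 1 = 1" using abs_q2_sqrt3_of_rat[of 1] by simp
    ultimately show ?thesis
      using abs_q2_sqrt3_ultra[of "y k" "1 - y k"] y_le[of k] by simp
  qed
  have d_determined: "d k = d l" if "y k = y l" for k l
  proof -
    have "(1 / 2 :: real) ^ d k = (1 / 2) ^ d l"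
      using y_minus_1[of k] y_minus_1[of l] that by (simp add: y_unit)
    thus ?thesis by (simp add: power_one_over)
  qed
  have "y 0 \<in> Q_adjoin_sqrt3"
  proof -
    have "inverse (of_rat (2 ^ f 0)) \<in> Q_adjoin_sqrt3"
      by (intro Q_adjoin_sqrt3_inverse of_rat_in_Q_adjoin_sqrt3)
    hence "s * inverse (2 ^ f 0) \<in> Q_adjoin_sqrt3"
      using Q_adjoin_sqrt3_mult[OF s] by (simp add: of_rat_power)
    thus ?thesis by (simp add: y_def S_def t_def divide_inverse)
  qed
  hence "finite (range y)" using d_ge y_le y_Suc by (rule finite_orbit)
  hence "\<not> inj y" using finite_imageD[of y UNIV] by auto
  then obtain j k where jk: "j < k" "y j = y k" by (metis injI linorder_neqE_nat)
  define p where "p = k - j"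
  define c where "c = f k - f j"
  have fk: "f k = f j + c" using strict_monoD[OF f jk(1)] by (simp add: c_def)
  have "y (n + p) = y n \<and> f (n + p) = f n + c" if "n \<ge> j" for n
    using that
  proof (induct n rule: dec_induct)
    case base
    show ?case using jk fk by (simp add: p_def)
  next
    case (step n)
    hence "d (n + p) = d n" by (intro d_determined) simp
    thus ?case using step(3) by (simp add: y_Suc f_Suc)
  qed
  thus ?thesis using that[of p j c] jk(1) by (simp add: p_def)
qed

section \<open>Admissible functions and the criterion\<close>

lemma abs2_power_2: "abs2 (2 ^ k) = (1 / 2) ^ k"
  using abs_q2_sqrt3_power[of 2 k] abs_q2_sqrt3_of_rat[of "2 ^ k"] by (simp add: of_rat_power)

lemma admissible_downward_closed:
  assumes "admissible \<psi>" "n \<in> finite_domain \<psi>" "m \<le> n"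
  shows "m \<in> finite_domain \<psi>"
proof -
  consider N where "finite_domain \<psi> = {i. i \<le> N}" | "finite_domain \<psi> = UNIV"
    using assms(1) unfolding admissible_def by blast
  thus ?thesis by cases (use assms(2,3) in auto)
qed

lemma admissible_the_enat_less:
  assumes "admissible \<psi>" "n \<in> finite_domain \<psi>" "m < n"
  shows "the_enat (\<psi> m) < the_enat (\<psi> n)"
proof -
  have m: "m \<in> finite_domain \<psi>" using admissible_downward_closed assms by (metis less_imp_le)
  hence "\<psi> m < \<psi> n"
    using assms unfolding admissible_def by (meson strict_mono_onD)
  thus ?thesis using m assms(2) by (auto simp: finite_domain_def)
qed

lemma admissible_ge:
  assumes "admissible \<psi>" "n \<in> finite_domain \<psi>"
  shows "n \<le> the_enat (\<psi> n)"
  using assms(2)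
proof (induct n)
  case (Suc n)
  have "n \<in> finite_domain \<psi>" using admissible_downward_closed[OF assms(1) Suc(2)] by simp
  thus ?case using Suc admissible_the_enat_less[OF assms(1) Suc(2), of n] by simp
qed simp

theorem mainTheorem3:
  fixes \<psi> :: "nat \<Rightarrow> enat"
  assumes "admissible \<psi>"
  shows "rational_fps (G_series \<psi>) \<longleftrightarrow>
    fps_value (G_series \<psi>) (1 / sqrt3) \<in> Q_adjoin_sqrt3 \<inter> Z2_adjoin_sqrt3"
proof -
  let ?F = "G_series \<psi>"
  let ?v = "fps_value ?F (1 / sqrt3)"
  define e :: "nat \<Rightarrow> real" where "e n = (1 / 2) ^ n" for n
  have e: "antimono e" "e \<longlonglongrightarrow> 0"
    by (auto simp: e_def[abs_def] antimono_def intro!: power_decreasing LIMSEQ_power_zero)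
  have coeff_le: "abs2 (fps_nth ?F n) \<le> e n" for n
    using admissible_ge[OF assms, of n]
    by (auto simp: G_series_def abs2_power_2 e_def intro!: power_decreasing)
  obtain s where s: "\<And>N. abs_q2_sqrt3 (s - (\<Sum>n<N. of_rat (fps_nth ?F n) * (1 / sqrt3) ^ n)) \<le> e N"
    and sums: "(\<lambda>n. of_rat (fps_nth ?F n) * (1 / sqrt3) ^ n) sums s"
    by (rule inverse_sqrt3_series_limit[OF coeff_le e]) blast
  have v: "?v = s" unfolding fps_value_def using sums by (rule sums_unique[symmetric])
  have "abs_q2_sqrt3 s \<le> 1" using s[of 0] by (simp add: e_def)
  hence integral: "s \<in> Z2_adjoin_sqrt3"
    unfolding Z2_adjoin_sqrt3_def Z2_def abs_q2_sqrt3_le_1_iff by (cases s) auto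
  have "1 / sqrt3 \<in> Q_adjoin_sqrt3"
    using Q_adjoin_sqrt3_inverse[OF sqrt3_in_Q_adjoin_sqrt3] by (simp add: divide_inverse)
  hence forward: "s \<in> Q_adjoin_sqrt3" if "rational_fps ?F"
    using rational_fps_value[OF that sums] by blast
  have backward: "rational_fps ?F" if sQ: "s \<in> Q_adjoin_sqrt3"
  proof (cases "finite_domain \<psi> = UNIV")
    case False
    then obtain N where "finite_domain \<psi> = {i. i \<le> N}" using assms unfolding admissible_def by blast
    \<comment> \<open>A polynomial satisfies the recurrence with factor 0 beyond its degree.\<close>
    thus ?thesis by (intro rational_fps_if_recurrence[of 1 "Suc N" _ 0]) (auto simp: G_series_def)
  next
    case True
    define f where "f n = the_enat (\<psi> n)" for n
    have F: "fps_nth ?F n = 2 ^ f n" for n by (simp add: G_series_def f_def True)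
    have f: "strict_mono f"
      using admissible_the_enat_less[OF assms] by (auto simp: True f_def strict_mono_def)
    \<comment> \<open>The geometric bound \<open>e\<close> is too weak here: integrality of the normalised tails requires each
      tail to be bounded by its own first term.\<close>
    define e' :: "nat \<Rightarrow> real" where "e' n = (1 / 2) ^ f n" for n
    have antimono: "antimono e'"
      using f by (auto simp: e'_def antimono_def strict_mono_less_eq intro!: power_decreasing)
    have lim: "e' \<longlonglongrightarrow> 0"
      using LIMSEQ_subseq_LIMSEQ[OF e(2) f] by (simp add: e_def e'_def[abs_def] comp_def)
    have coeff_le': "abs2 (fps_nth ?F n) \<le> e' n" for n by (simp add: F abs2_power_2 e'_def)
    obtain s' where
      s': "\<And>N. abs_q2_sqrt3 (s' - (\<Sum>n<N. of_rat (fps_nth ?F n) * (1 / sqrt3) ^ n)) \<le> e' N"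
      and "(\<lambda>n. of_rat (fps_nth ?F n) * (1 / sqrt3) ^ n) sums s'"
      by (rule inverse_sqrt3_series_limit[OF coeff_le' antimono lim]) blast
    hence "s' = s" using sums sums_unique2 by blast
    hence tail: "abs_q2_sqrt3 (s - (\<Sum>n<N. 2 ^ f n * (1 / sqrt3) ^ n)) \<le> (1 / 2) ^ f N" for N
      using s'[of N] by (simp add: F e'_def of_rat_power)
    obtain j p c where p: "p > 0" and c: "\<And>n. n \<ge> j \<Longrightarrow> f (n + p) = f n + c"
      by (rule eventually_periodic_gaps[OF f sQ tail]) blast
    show ?thesis
      by (rule rational_fps_if_recurrence[OF p, of j _ "2 ^ c"]) (simp add: F c power_add)
  qed
  show ?thesis using forward backward integral v by auto
qed

end
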